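(* Let $\mathbf Q=\{Q_i\}_{i\in\Lambda}$ be the well ordered set of key polynomials of $\nu'$ produced by the construction described in the context, and let $n=[L:K]$. If $\mathrm{char}\,K=0$ then the order type of $\mathbf Q$ is at most $\omega$ (the order type of $\mathbb N$). If $\mathrm{char}\,K=p>0$ then the order type of $\mathbf Q$ is bounded above by $([\log_pn]+1)\omega$, i.e. by the ordinal $\omega+\omega+\dots+\omega$ ($[\log_pn]+1$ summands), where $[\cdot]$ is the integer part.
   Context: SETTING. $\mathbb N$ is the set of non-negative integers. $K\hookrightarrow L$ is a finite separable field extension, $\nu:K^*\to\Gamma$ a valuation of rank $1$ with valuation ring $R_\nu$, where $\Gamma$ is a $\mathbb Q$-divisible ordered group containing $\nu(K^* )$ (limits and suprema are taken in $\Gamma\cup\{\infty\}$; one may take $\Gamma=\mathbb R$); $\Gamma_+$ is the set of non-negative elements of $\Gamma$. Put $p=1$ if $\mathrm{char}\,K=0$ and $p=\mathrm{char}\,K$ otherwise. $L=K[x]$; $f=\sum_{i=0}^na_iX^i\in K[X]$ is the monic minimal polynomial of $x$, of degree $n$, and $x$ is scaled so that $\nu(a_i)>0$ for $i<n$. $\nu'$ is an extension of $\nu$ to $L$ with values in $\Gamma$. For $y\in L$, $y(X)$ is its representative in $K[X]$ of degree $<n$ (elements of $L$ and their representatives are often not distinguished); for $h\in K[X]$, $\nu'(h):=\nu'(h(x))$, with $\nu'(0)=\infty$. $\mathbf P'_\beta=\{y\in L:\nu'(y)\ge\beta\}$, $\mathbf P'_{\beta+}=\{y\in L:\nu'(y)>\beta\}$,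 $G_{\nu'}=\bigoplus_\beta\mathbf P'_\beta/\mathbf P'_{\beta+}$, and $G_\nu\subset G_{\nu'}$ is defined in the same way from $K$ and $\nu$. $\mathrm{in}_{\nu'}y$ is the image of $y\ne0$ in degree $\nu'(y)$; similarly $\mathrm{in}_\nu$. KEY POLYNOMIALS are elements $Q_i\in L$ indexed by ordinals $i\ge1$, with integers $\alpha_i\ge1$ (all but finitely many equal to $1$) and values $\beta_i=\nu'(Q_i)$; $\mathbf Q_l=\{Q_i\}_{i<l}$. $Q_i(X)$ is monic of degree $\prod_{j\le i}\alpha_j$. STANDARD EXPANSIONS (given $Q_i,\alpha_i$ for $i\le l$). An index $i<l$ is $l$-essential if there is a positive integer $t$ with $i+t=l$, or with $i+t<l$ and $\alpha_{i+t}>1$; otherwise $l$-inessential. Put $i+:=i+1$ if $i$ is $l$-essential, $i+:=i+\omega$ otherwise. A multi-index $(\gamma_i)_{i\le l}$ with finite support is standard if $0\le\gamma_i<\alpha_{i+}$ (for $i<l$), $\sum_{i\le l}\gamma_i\prod_{j\le i}\alpha_j\le n$, and for every $l$-inessential $i$ at most one $j<i+$ with $j+=i+$ has $\gamma_j\ne0$. An $l$-standard monomial is $c\prod_{i\le l}Q_i^{\gamma_i}$ with $c\in K$ and $(\gamma_i)$ standard. An $l$-standard expansion not involving $Q_l$ is a finite sum of $l$-standard monomials not involving $Q_l$ such that, for each value $\beta$ occurring, the sum of the $\mathrm{in}_{\nu'}$ of the monomials of value $\beta$ is non-zero; it is homogeneous if all its monomials have the same value. An $l$-standard expansion of $h\in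 K[X]$ is $h=\sum_{j=0}^sd_jQ_l^j$ with each $d_j$ an $l$-standard expansion not involving $Q_l$ (obtained by successive Euclidean division by $Q_l(X)$; the $d_j$ are uniquely determined by $h$). It is weakly affine (used if $\mathrm{char}\,K>0$) if $d_j=0$ whenever $j>0$ is not a power $p^e$, $e\in\mathbb N$. For such $h$: $\nu_l(h)=\min_j\{j\beta_l+\nu'(d_j)\}$; $S_l(h,\beta_l)=\{j: j\beta_l+\nu'(d_j)=\nu_l(h)\}$; $\mathrm{in}_lh=\sum_{j\in S_l(h,\beta_l)}\mathrm{in}_{\nu'}d_j\,\bar Q_l^j$, with $\bar Q_l$ a new variable; $\delta_l(h)=\max S_l(h,\beta_l)$; $\nu_l^+(h)=\min\{\nu'(d_jQ_l^j):\delta_l(h)<j\le s\}$ and $\epsilon_l(h)$ is the largest $j>\delta_l(h)$ attaining this minimum (both are $\infty$ if there is no such $j$). The Newton polygon $\Delta_l(h)$ is the convex hull of $\bigcup_j\big((\nu'(d_j),j)+(\Gamma_+\oplus\mathbb Q_+)\big)$; $\beta$ determines a side of it if $j\beta+\nu'(d_j)$ attains its minimum for at least two $j$. CONSTRUCTION. $Q_1=x$, $\alpha_1=1$. Suppose $Q_i$, $i\le l$, are defined and $Q_l\ne0$; let $f=\sum_ja_{jl}Q_l^j$ be the $l$-standard expansion of $f$. Factor $\mathrm{in}_lf$ into monic irreducible factors in $G_\nu[\mathrm{in}_{\nu'}\mathbf Q_l][\bar Q_l]$ (up to a factor not involving $\bar Q_l$); let $t$ be the number of distinct factors, $g_{1l}$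 the factor which is the minimal polynomial of $\mathrm{in}_{\nu'}Q_l$ over $G_\nu[\mathrm{in}_{\nu'}\mathbf Q_l]$, and $\alpha_{l+1}=\deg_{\bar Q_l}g_{1l}$. (A) If $(t,\alpha_{l+1})\neq(1,1)$, write $g_{1l}=\bar Q_l^{\alpha_{l+1}}+\sum_{j<\alpha_{l+1}}\big(\sum_\gamma\bar c_{j\gamma}\,\mathrm{in}_{\nu'}\mathbf Q_l^\gamma\big)\bar Q_l^j$ with $\bar c_{j\gamma}\in G_\nu$ and standard monomials, and put $Q_{l+1}=Q_l^{\alpha_{l+1}}+\sum_{j<\alpha_{l+1}}\big(\sum_\gamma c_{j\gamma}\mathbf Q_l^\gamma\big)Q_l^j$, with $c_{j\gamma}\in K$ representing $\bar c_{j\gamma}$ (a lifting of $g_{1l}$). (B) If $t=\alpha_{l+1}=1$, let $\delta=\delta_l(f)$. Consider $Q'=Q_l+z_l+\dots+z_i$ ($i=l+r$, $r\in\mathbb N$), with $z_j$ homogeneous $l$-standard expansions not involving $Q_l$ and $\beta_l=\nu'(z_l)<\dots<\nu'(z_i)$; $Q'=Q_l$ is also allowed. Write $f=\sum_ja'_jQ'^j$ with $a'_j$ $l$-standard expansions not involving $Q_l$, with Newton polygon $\Delta(f,Q')$ (the hull of the $(\nu'(a'_j),j)+(\Gamma_+\oplus\mathbb Q_+)$). The point $(\nu'(a_{\delta l}),\delta)$ is a vertex of it; the characteristic side $A(f,Q')$ is the side with this upper endpoint, $\beta(Q')$ is the element determining it, and $\mathrm{in}_{A(f,Q')}f=\sum_{(\nu'(a'_j),j)\in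 A(f,Q')}\mathrm{in}_{\nu'}a'_j\bar Q^j$. With $Q'_j=Q_l+z_l+\dots+z_{j-1}$, let $T$ be the set of all such $Q'$ with $\nu'(z_i)<\beta(Q')$ and $\mathrm{in}_{A(f,Q'_j)}f=\mathrm{in}_{\nu'}a'_\delta(\bar Q+\mathrm{in}_{\nu'}z_j)^\delta$ for $l\le j<i$ ($a'_\delta$ taken in the expansion with respect to $Q'_j$), partially ordered by declaring $Q_l+z_l+\dots+z_{i-1}$ to be the immediate predecessor of $Q_l+z_l+\dots+z_i$. - If $\mathrm{char}\,K=0$: write $\frac{a_{\delta-1,l}}{\delta a_{\delta l}}=z_l+\dots+z_{l_1-1}+\phi+w$, $l_1>l$, with $z_j$ homogeneous $l$-standard expansions not involving $Q_l$, $\nu'\big(\frac{a_{\delta-1,l}}{\delta a_{\delta l}}\big)=\nu'(z_l)<\dots<\nu'(z_{l_1-1})<\nu_l^+(f)-\nu_l(f)+\beta_l$, $\phi$ a sum of standard monomials of value $\ge\nu_l^+(f)-\nu_l(f)+\beta_l$, and $w$ divisible by $Q_l+\frac{a_{\delta-1,l}}{\delta a_{\delta l}}$. Let $s=\max\{i: l\le i\le l_1,\ Q_l+z_l+\dots+z_{i-1}\in T\}$ and $Q_i=Q_l+z_l+\dots+z_{i-1}$ for $l<i\le s$. - If $\mathrm{char}\,K=p>0$, Case 1: $T$ has a maximal element $Q_l+z_l+\dots+z_{s-1}$; put $Q_i=Q_l+z_l+\dots+z_{i-1}$ for $l+1\le i\le s$. Case 2: $T$ has no maximal element; let $\bar\beta=\sup\{\nu'(Q'):Q'\in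 T\}$, choose an infinite sequence $z_l,z_{l+1},\dots$ with $Q_l+z_l+\dots+z_{l+t}\in T$ for all $t\in\mathbb N$ and $\lim_t\nu'(Q_l+z_l+\dots+z_{l+t})=\bar\beta$, and put $Q_{l+t}=Q_l+z_l+\dots+z_{l+t-1}$. Case 2a: $\bar\beta=\infty$. Case 2b: $\bar\beta<\infty$. In (B), $\alpha_i=1$ for the new $Q_i$. (C) Limit step (Case 2b). Replace $l$ by some $l+s$ so that $\alpha_{l+t}=1$ for all $t>0$ and $\delta_{l+t}(f)=\delta$ is constant; write $\delta=p^eu$, $p\nmid u$. Let $Q_{l+\omega}$ be a weakly affine $i$-standard expansion for some $i\in\{l+t\}_{t\in\mathbb N}$, monic of degree $p^{e_0}$ in $Q_i$, $1\le e_0\le e$, with $\bar\beta\le\frac1{p^{e_0}}\nu'(Q_{l+\omega})$, chosen with $e_0$ minimal; $\alpha_{l+\omega}=p^{e_0}$. STOPPING. The construction stops if some $Q_i=0$ in $L$, or if it has produced an infinite sequence $\{Q_{l+t}\}_{t\in\mathbb N}$ and either $\mathrm{char}\,K=0$ or $\lim_t\beta_{l+t}=\infty$; otherwise an infinite sequence is followed by step (C). The set obtained is $\mathbf Q=\{Q_i\}_{i\in\Lambda}$. *)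

theory Defs
  imports
    "HOL-Library.Poly_Mapping"
    "HOL-Library.Extended_Real"
    "HOL-Library.Product_Lexorder"
    "HOL-Computational_Algebra.Computational_Algebra"
    "HOL-Algebra.UnivPoly"
    "HOL-Algebra.QuotRing"
    "HOL-Algebra.Generated_Rings"
    "HOL-Algebra.Ring_Divisibility"
begin

unbundle cardinal_syntax

section \<open>Ordinals below $\omega^2$\<close>

text \<open>
  The pair \<open>(a, b)\<close> stands for the ordinal $\omega a + b$; the lexicographic order on pairs is the
  order of ordinals.  The construction has no rule for a limit of limit ordinals, so these are all
  the indices that can occur.
\<close>

type_synonym idx = "nat \<times> nat"

definition first_idx :: idx where "first_idx = (0, 1)"

definition idx_add :: "idx \<Rightarrow> nat \<Rightarrow> idx"  (infixl \<open>\<oplus>\<^sub>i\<close> 65)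
  where "i \<oplus>\<^sub>i t = (fst i, snd i + t)"

definition add_omega :: "idx \<Rightarrow> idx"
  where "add_omega i = (Suc (fst i), 0)"

definition order_on_idx :: "idx set \<Rightarrow> idx rel"
  where "order_on_idx A = {(i, j). i \<in> A \<and> j \<in> A \<and> i \<le> j}"

text \<open>The well-order $\omega + \dots + \omega$ with \<open>k\<close> summands.\<close>

definition omega_times :: "nat \<Rightarrow> idx rel"
  where "omega_times k = order_on_idx {i. fst i < k}"


section \<open>Field extensions and valuations\<close>

definition field_embedding :: "('k::field \<Rightarrow> 'l::field) \<Rightarrow> bool"
  where "field_embedding \<iota> \<longleftrightarrow>
    \<iota> 1 = 1 \<and> (\<forall>a b. \<iota> (a + b) = \<iota> a + \<iota> b) \<and> (\<forall>a b. \<iota> (a * b) = \<iota> a * \<iota> b)"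

definition finite_extension :: "('k::field \<Rightarrow> 'l::field) \<Rightarrow> bool"
  where "finite_extension \<iota> \<longleftrightarrow>
    (\<exists>B. finite B \<and> module.span (\<lambda>c y. \<iota> c * y) B = (UNIV :: 'l set))"

definition extension_degree :: "('k::field \<Rightarrow> 'l::field) \<Rightarrow> nat"
  where "extension_degree \<iota> = vector_space.dim (\<lambda>c y. \<iota> c * y) (UNIV :: 'l set)"

definition separable_extension :: "('k::field \<Rightarrow> 'l::field) \<Rightarrow> bool"
  where "separable_extension \<iota> \<longleftrightarrow>
    (\<forall>y. \<exists>g. Factorial_Ring.irreducible g \<and> poly (map_poly \<iota> g) y = 0 \<and> coprime g (pderiv g))"

definition valuation :: "('a::field \<Rightarrow> ereal) \<Rightarrow> bool"
  where "valuation v \<longleftrightarrow>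
    (\<forall>y. v y \<noteq> -\<infinity>) \<and> (\<forall>y. v y = \<infinity> \<longleftrightarrow> y = 0) \<and>
    (\<forall>y z. v (y * z) = v y + v z) \<and> (\<forall>y z. min (v y) (v z) \<le> v (y + z))"

text \<open>For a real-valued valuation, rank one means non-trivial.\<close>

definition rank_one_valuation :: "('a::field \<Rightarrow> ereal) \<Rightarrow> bool"
  where "rank_one_valuation v \<longleftrightarrow> valuation v \<and> (\<exists>y. y \<noteq> 0 \<and> v y \<noteq> 0)"


section \<open>The graded algebra of a valuation\<close>

text \<open>
  An element of the monoid algebra \<open>real \<Rightarrow>\<^sub>0 'a\<close> is a finitely supported family $(u_\beta)$,
  multiplied by convolution.  Those with $u_\beta \in P_\beta$ form the ring
  $\bigoplus_\beta P_\beta$, in which $\bigoplus_\beta P_{\beta+}$ is an ideal; the quotient is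
  $\bigoplus_\beta P_\beta / P_{\beta+}$.
\<close>

definition P_sum :: "('a::field \<Rightarrow> ereal) \<Rightarrow> (real \<Rightarrow>\<^sub>0 'a) ring"
  where "P_sum v =
    \<lparr>carrier = {u. \<forall>\<beta>. ereal \<beta> \<le> v (Poly_Mapping.lookup u \<beta>)}, mult = (*), one = 1, zero = 0, add = (+)\<rparr>"

definition P_plus_sum :: "('a::field \<Rightarrow> ereal) \<Rightarrow> (real \<Rightarrow>\<^sub>0 'a) set"
  where "P_plus_sum v = {u. \<forall>\<beta>. ereal \<beta> < v (Poly_Mapping.lookup u \<beta>)}"

definition graded_algebra :: "('a::field \<Rightarrow> ereal) \<Rightarrow> (real \<Rightarrow>\<^sub>0 'a) set ring"
  where "graded_algebra v = P_sum v Quot P_plus_sum v"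

text \<open>The value at \<open>0\<close> is the zero of the graded algebra.\<close>

definition initial_form :: "('a::field \<Rightarrow> ereal) \<Rightarrow> 'a \<Rightarrow> (real \<Rightarrow>\<^sub>0 'a) set"
  where "initial_form v y =
    P_plus_sum v +>\<^bsub>P_sum v\<^esub> Poly_Mapping.single (real_of_ereal (v y)) y"

definition graded_subalgebra ::
    "('k::field \<Rightarrow> 'a::field) \<Rightarrow> ('a \<Rightarrow> ereal) \<Rightarrow> (real \<Rightarrow>\<^sub>0 'a) set set"
  where "graded_subalgebra \<iota> v =
    {P_plus_sum v +>\<^bsub>P_sum v\<^esub> u | u. u \<in> carrier (P_sum v) \<and> range (Poly_Mapping.lookup u) \<subseteq> range \<iota>}"


section \<open>Polynomials over a subring of a ring\<close>

definition monic_up :: "('g, 'm) ring_scheme \<Rightarrow> (nat \<Rightarrow> 'g) \<Rightarrow> bool"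
  where "monic_up R g \<longleftrightarrow> g \<in> carrier (UP R) \<and> g (deg R g) = \<one>\<^bsub>R\<^esub>"

definition is_minimal_polynomial :: "'g ring \<Rightarrow> 'g set \<Rightarrow> 'g \<Rightarrow> (nat \<Rightarrow> 'g) \<Rightarrow> bool"
  where "is_minimal_polynomial G S y g \<longleftrightarrow>
    (let R = G\<lparr>carrier := S\<rparr> in
      monic_up R g \<and> UnivPoly.eval R G (\<lambda>a. a) y g = \<zero>\<^bsub>G\<^esub> \<and>
      (\<forall>h \<in> carrier (UP R).
        h \<noteq> \<zero>\<^bsub>UP R\<^esub> \<and> UnivPoly.eval R G (\<lambda>a. a) y h = \<zero>\<^bsub>G\<^esub> \<longrightarrow> deg R g \<le> deg R h))"

definition monic_factorization :: "'g ring \<Rightarrow> (nat \<Rightarrow> 'g) \<Rightarrow> (nat \<Rightarrow> 'g) set \<Rightarrow> bool"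
  where "monic_factorization R h F \<longleftrightarrow>
    finite F \<and> (\<forall>g \<in> F. monic_up R g \<and> ring_irreducible\<^bsub>UP R\<^esub> g) \<and>
    (\<exists>c m. c \<in> carrier R \<and> c \<noteq> \<zero>\<^bsub>R\<^esub> \<and> (\<forall>g \<in> F. 1 \<le> m g) \<and>
       h = up_ring.monom (UP R) c 0 \<otimes>\<^bsub>UP R\<^esub>
           (\<Otimes>\<^bsub>UP R\<^esub> g \<in> F. g [^]\<^bsub>UP R\<^esub> (m g :: nat)))"


section \<open>Key polynomials\<close>

text \<open>Coefficients of the expansion of \<open>h\<close> in powers of \<open>q\<close> by successive Euclidean division.\<close>

definition digit :: "'k::field poly \<Rightarrow> 'k poly \<Rightarrow> nat \<Rightarrow> 'k poly"
  where "digit q h j = (h div q ^ j) mod q"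

subsection \<open>Standard multi-indices\<close>

definition essential :: "(idx \<Rightarrow> nat) \<Rightarrow> idx \<Rightarrow> idx \<Rightarrow> bool"
  where "essential \<alpha> l i \<longleftrightarrow>
    i < l \<and> (\<exists>t>0. i \<oplus>\<^sub>i t = l \<or> (i \<oplus>\<^sub>i t < l \<and> \<alpha> (i \<oplus>\<^sub>i t) > 1))"

definition succ_idx :: "(idx \<Rightarrow> nat) \<Rightarrow> idx \<Rightarrow> idx \<Rightarrow> idx"
  where "succ_idx \<alpha> l i = (if essential \<alpha> l i then i \<oplus>\<^sub>i 1 else add_omega i)"

text \<open>The product of all $\alpha_j$, $j \le i$, almost all of which are \<open>1\<close>.\<close>

definition alpha_prod :: "(idx \<Rightarrow> nat) \<Rightarrow> idx \<Rightarrow> nat"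
  where "alpha_prod \<alpha> i = (\<Prod>j \<in> {j. first_idx \<le> j \<and> j \<le> i \<and> \<alpha> j \<noteq> 1}. \<alpha> j)"

definition standard_index :: "nat \<Rightarrow> (idx \<Rightarrow> nat) \<Rightarrow> idx \<Rightarrow> (idx \<Rightarrow> nat) \<Rightarrow> bool"
  where "standard_index n \<alpha> l \<gamma> \<longleftrightarrow>
    finite {i. \<gamma> i \<noteq> 0} \<and> {i. \<gamma> i \<noteq> 0} \<subseteq> {first_idx..l} \<and>
    (\<forall>i \<in> {first_idx..<l}. \<gamma> i < \<alpha> (succ_idx \<alpha> l i)) \<and>
    (\<Sum>i \<in> {i. \<gamma> i \<noteq> 0}. \<gamma> i * alpha_prod \<alpha> i) \<le> n \<and>
    (\<forall>i \<in> {first_idx..<l}. \<not> essential \<alpha> l i \<longrightarrow>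
       (\<forall>j k. j \<in> {first_idx..<succ_idx \<alpha> l i} \<and> k \<in> {first_idx..<succ_idx \<alpha> l i} \<and>
          succ_idx \<alpha> l j = succ_idx \<alpha> l i \<and> succ_idx \<alpha> l k = succ_idx \<alpha> l i \<and>
          \<gamma> j \<noteq> 0 \<and> \<gamma> k \<noteq> 0 \<longrightarrow> j = k))"

definition monomial :: "(idx \<Rightarrow> 'k::field poly) \<Rightarrow> (idx \<Rightarrow> nat) \<Rightarrow> 'k \<Rightarrow> 'k poly"
  where "monomial Q \<gamma> c = Polynomial.smult c (\<Prod>i \<in> {i. \<gamma> i \<noteq> 0}. Q i ^ \<gamma> i)"


locale valued_extension =
  fixes \<iota> :: "'k::field \<Rightarrow> 'l::field"
    and \<nu> :: "'k \<Rightarrow> ereal"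
    and \<nu>' :: "'l \<Rightarrow> ereal"
    and x :: 'l
    and f :: "'k poly"
  assumes embedding: "field_embedding \<iota>"
    and finite_ext: "finite_extension \<iota>"
    and separable: "separable_extension \<iota>"
    and rank_one: "rank_one_valuation \<nu>"
    and valuation: "valuation \<nu>'"
    and extends: "\<nu>' (\<iota> c) = \<nu> c"
    and generates: "\<exists>h. y = poly (map_poly \<iota> h) x"
    and min_poly_monic: "lead_coeff f = 1"
    and min_poly_root: "poly (map_poly \<iota> f) x = 0"
    and min_poly_least: "h \<noteq> 0 \<Longrightarrow> poly (map_poly \<iota> h) x = 0 \<Longrightarrow> degree f \<le> degree h"
    and scaled: "i < degree f \<Longrightarrow> \<nu> (Polynomial.coeff f i) > 0"
begin

text \<open>
  Key polynomials are carried as elements of $K[X]$; the element of $L$ is the image under \<open>ev\<close>.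
\<close>

definition ev :: "'k poly \<Rightarrow> 'l"
  where "ev h = poly (map_poly \<iota> h) x"

definition val :: "'k poly \<Rightarrow> ereal"
  where "val h = \<nu>' (ev h)"

definition init :: "'k poly \<Rightarrow> (real \<Rightarrow>\<^sub>0 'l) set"
  where "init h = initial_form \<nu>' (ev h)"

definition G :: "(real \<Rightarrow>\<^sub>0 'l) set ring"
  where "G = graded_algebra \<nu>'"

text \<open>The ring $G_\nu[\mathrm{in}_{\nu'}\mathbf Q_l]$.\<close>

definition G_less :: "(idx \<Rightarrow> 'k poly) \<Rightarrow> idx \<Rightarrow> (real \<Rightarrow>\<^sub>0 'l) set set"
  where "G_less Q l =
    generate_ring G (graded_subalgebra \<iota> \<nu>' \<union> (\<lambda>i. init (Q i)) ` {first_idx..<l})"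


subsection \<open>Standard expansions\<close>

definition standard_monomial :: "(idx \<Rightarrow> nat) \<Rightarrow> idx \<Rightarrow> (idx \<Rightarrow> nat) \<Rightarrow> bool"
  where "standard_monomial \<alpha> l \<gamma> \<longleftrightarrow> standard_index (degree f) \<alpha> l \<gamma>"

definition standard_sum_below ::
    "(idx \<Rightarrow> 'k poly) \<Rightarrow> (idx \<Rightarrow> nat) \<Rightarrow> idx \<Rightarrow> (idx \<Rightarrow> nat) set \<Rightarrow> ((idx \<Rightarrow> nat) \<Rightarrow> 'k) \<Rightarrow> bool"
  where "standard_sum_below Q \<alpha> l M c \<longleftrightarrow>
    finite M \<and> (\<forall>\<gamma> \<in> M. standard_monomial \<alpha> l \<gamma> \<and> \<gamma> l = 0 \<and> c \<gamma> \<noteq> 0) \<and>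
    (\<forall>\<gamma> \<in> M. (\<Oplus>\<^bsub>G\<^esub> \<gamma>' \<in> {\<gamma>' \<in> M. val (monomial Q \<gamma>' (c \<gamma>')) = val (monomial Q \<gamma> (c \<gamma>))}.
        init (monomial Q \<gamma>' (c \<gamma>'))) \<noteq> \<zero>\<^bsub>G\<^esub>)"

definition standard_below :: "(idx \<Rightarrow> 'k poly) \<Rightarrow> (idx \<Rightarrow> nat) \<Rightarrow> idx \<Rightarrow> 'k poly \<Rightarrow> bool"
  where "standard_below Q \<alpha> l d \<longleftrightarrow>
    (\<exists>M c. standard_sum_below Q \<alpha> l M c \<and> d = (\<Sum>\<gamma> \<in> M. monomial Q \<gamma> (c \<gamma>)))"

definition homogeneous_below :: "(idx \<Rightarrow> 'k poly) \<Rightarrow> (idx \<Rightarrow> nat) \<Rightarrow> idx \<Rightarrow> 'k poly \<Rightarrow> bool"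
  where "homogeneous_below Q \<alpha> l d \<longleftrightarrow>
    (\<exists>M c b. standard_sum_below Q \<alpha> l M c \<and> d = (\<Sum>\<gamma> \<in> M. monomial Q \<gamma> (c \<gamma>)) \<and>
       (\<forall>\<gamma> \<in> M. val (monomial Q \<gamma> (c \<gamma>)) = b))"

text \<open>
  The expansion of \<open>h\<close> in powers of \<open>q\<close> has \<open>l\<close>-standard coefficients not involving $Q_l$; for
  \<open>q = Q l\<close> this is the \<open>l\<close>-standard expansion of \<open>h\<close>.
\<close>

definition standard_expansion ::
    "(idx \<Rightarrow> 'k poly) \<Rightarrow> (idx \<Rightarrow> nat) \<Rightarrow> idx \<Rightarrow> 'k poly \<Rightarrow> 'k poly \<Rightarrow> bool"
  where "standard_expansion Q \<alpha> l q h \<longleftrightarrow> (\<forall>j. standard_below Q \<alpha> l (digit q h j))"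

definition weakly_affine_expansion ::
    "(idx \<Rightarrow> 'k poly) \<Rightarrow> (idx \<Rightarrow> nat) \<Rightarrow> idx \<Rightarrow> 'k poly \<Rightarrow> bool"
  where "weakly_affine_expansion Q \<alpha> l h \<longleftrightarrow>
    standard_expansion Q \<alpha> l (Q l) h \<and>
    (\<forall>j>0. (\<nexists>e. j = CHAR('k) ^ e) \<longrightarrow> digit (Q l) h j = 0)"


subsection \<open>Newton polygons\<close>

text \<open>
  All terms of index greater than \<open>degree h\<close> vanish, so the minimum may be taken up to there.
\<close>

definition line_value :: "'k poly \<Rightarrow> 'k poly \<Rightarrow> ereal \<Rightarrow> nat \<Rightarrow> ereal"
  where "line_value q h b j = ereal (real j) * b + val (digit q h j)"

definition min_value :: "'k poly \<Rightarrow> 'k poly \<Rightarrow> ereal \<Rightarrow> ereal"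
  where "min_value q h b = Min (line_value q h b ` {..degree h})"

definition support_on :: "'k poly \<Rightarrow> 'k poly \<Rightarrow> ereal \<Rightarrow> nat set"
  where "support_on q h b = {j. j \<le> degree h \<and> line_value q h b j = min_value q h b}"

definition init_on :: "'k poly \<Rightarrow> 'k poly \<Rightarrow> ereal \<Rightarrow> nat \<Rightarrow> (real \<Rightarrow>\<^sub>0 'l) set"
  where "init_on q h b = (\<lambda>j. if j \<in> support_on q h b then init (digit q h j) else \<zero>\<^bsub>G\<^esub>)"

text \<open>The following are $\nu_l(f)$, $\mathrm{in}_l f$, $\delta_l(f)$ and $\nu_l^+(f)$.\<close>

definition nu_l :: "(idx \<Rightarrow> 'k poly) \<Rightarrow> idx \<Rightarrow> ereal"
  where "nu_l Q l = min_value (Q l) f (val (Q l))"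

definition in_l :: "(idx \<Rightarrow> 'k poly) \<Rightarrow> idx \<Rightarrow> nat \<Rightarrow> (real \<Rightarrow>\<^sub>0 'l) set"
  where "in_l Q l = init_on (Q l) f (val (Q l))"

definition delta_l :: "(idx \<Rightarrow> 'k poly) \<Rightarrow> idx \<Rightarrow> nat"
  where "delta_l Q l = Max (support_on (Q l) f (val (Q l)))"

definition nu_l_plus :: "(idx \<Rightarrow> 'k poly) \<Rightarrow> idx \<Rightarrow> ereal"
  where "nu_l_plus Q l =
    (INF j \<in> {j. delta_l Q l < j \<and> j \<le> degree f}. val (digit (Q l) f j * Q l ^ j))"

text \<open>
  \<open>b\<close> is the element $\beta(Q')$ determining the side of $\Delta(f,Q')$ with upper endpoint
  $(\nu'(a_{\delta l}),\delta)$.  If $a'_j = 0$ for all $j < \delta$ there is no such side and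
  $\beta(Q') = \infty$; this happens exactly when $Q'$ vanishes in $L$.
\<close>

definition char_side :: "(idx \<Rightarrow> 'k poly) \<Rightarrow> idx \<Rightarrow> 'k poly \<Rightarrow> ereal \<Rightarrow> bool"
  where "char_side Q l q b \<longleftrightarrow>
    (let \<delta> = delta_l Q l in
      val (digit q f \<delta>) = val (digit (Q l) f \<delta>) \<and>
      (if b = \<infinity> then \<forall>j<\<delta>. digit q f j = 0
       else b \<noteq> -\<infinity> \<and> card (support_on q f b) \<ge> 2 \<and> Max (support_on q f b) = \<delta>))"


subsection \<open>Step (A)\<close>

definition lifting ::
    "(idx \<Rightarrow> 'k poly) \<Rightarrow> (idx \<Rightarrow> nat) \<Rightarrow> idx \<Rightarrow> (nat \<Rightarrow> (real \<Rightarrow>\<^sub>0 'l) set) \<Rightarrow> 'k poly \<Rightarrow> bool"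
  where "lifting Q \<alpha> l g q \<longleftrightarrow>
    (let a = deg (G\<lparr>carrier := G_less Q l\<rparr>) g in
      \<exists>M c. (\<forall>j<a. finite (M j) \<and>
               (\<forall>\<gamma> \<in> M j. standard_monomial \<alpha> l \<gamma> \<and> \<gamma> l = 0 \<and> c j \<gamma> \<noteq> 0) \<and>
               g j = (\<Oplus>\<^bsub>G\<^esub> \<gamma> \<in> M j. initial_form \<nu>' (\<iota> (c j \<gamma>)) \<otimes>\<^bsub>G\<^esub>
                        (\<Otimes>\<^bsub>G\<^esub> i \<in> {i. \<gamma> i \<noteq> 0}. init (Q i) [^]\<^bsub>G\<^esub> \<gamma> i))) \<and>
            q = Q l ^ a + (\<Sum>j<a. (\<Sum>\<gamma> \<in> M j. monomial Q \<gamma> (c j \<gamma>)) * Q l ^ j))"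


subsection \<open>Step (B)\<close>

text \<open>
  \<open>T_seq Q \<alpha> l zs\<close> says that \<open>Q l + sum_list zs\<close> belongs to \<open>T\<close> by virtue of the decomposition \<open>zs\<close>;
  the empty list accounts for \<open>Q l\<close> itself.
\<close>

definition T_seq :: "(idx \<Rightarrow> 'k poly) \<Rightarrow> (idx \<Rightarrow> nat) \<Rightarrow> idx \<Rightarrow> 'k poly list \<Rightarrow> bool"
  where "T_seq Q \<alpha> l zs \<longleftrightarrow> zs = [] \<or>
    (\<forall>z \<in> set zs. homogeneous_below Q \<alpha> l z) \<and>
    val (hd zs) = val (Q l) \<and> sorted_wrt (<) (map val zs) \<and>
    standard_expansion Q \<alpha> l (Q l + sum_list zs) f \<and>
    (\<exists>b. char_side Q l (Q l + sum_list zs) b \<and> val (last zs) < b) \<and>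
    (\<forall>k < length zs - 1.
       let q = Q l + sum_list (take k zs); \<delta> = delta_l Q l; P = UP G in
       \<exists>b. b \<noteq> \<infinity> \<and> char_side Q l q b \<and>
           init_on q f b =
             init (digit q f \<delta>) \<odot>\<^bsub>P\<^esub>
               (up_ring.monom P \<one>\<^bsub>G\<^esub> 1 \<oplus>\<^bsub>P\<^esub> up_ring.monom P (init (zs ! k)) 0) [^]\<^bsub>P\<^esub> \<delta>)"

definition T :: "(idx \<Rightarrow> 'k poly) \<Rightarrow> (idx \<Rightarrow> nat) \<Rightarrow> idx \<Rightarrow> 'k poly set"
  where "T Q \<alpha> l = {Q l + sum_list zs | zs. T_seq Q \<alpha> l zs}"

definition T_pred :: "(idx \<Rightarrow> 'k poly) \<Rightarrow> (idx \<Rightarrow> nat) \<Rightarrow> idx \<Rightarrow> 'k poly \<Rightarrow> 'k poly \<Rightarrow> bool"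
  where "T_pred Q \<alpha> l q q' \<longleftrightarrow> q \<in> T Q \<alpha> l \<and>
    (\<exists>zs z. T_seq Q \<alpha> l (zs @ [z]) \<and> q = Q l + sum_list zs \<and> q' = Q l + sum_list (zs @ [z]))"

definition T_maximal :: "(idx \<Rightarrow> 'k poly) \<Rightarrow> (idx \<Rightarrow> nat) \<Rightarrow> idx \<Rightarrow> 'k poly \<Rightarrow> bool"
  where "T_maximal Q \<alpha> l q \<longleftrightarrow>
    q \<in> T Q \<alpha> l \<and> (\<forall>q' \<in> T Q \<alpha> l. (T_pred Q \<alpha> l)\<^sup>*\<^sup>* q q' \<longrightarrow> q' = q)"

text \<open>
  In characteristic zero, \<open>h\<close> is $a_{\delta-1,l}/(\delta a_{\delta l}) \in L$.  Divisibility of \<open>w\<close>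
  is divisibility in the valuation ring of $\nu'$ (in the field $L$ it would be void).
\<close>

definition char_zero_decomposition ::
    "(idx \<Rightarrow> 'k poly) \<Rightarrow> (idx \<Rightarrow> nat) \<Rightarrow> idx \<Rightarrow> 'k poly list \<Rightarrow> bool"
  where "char_zero_decomposition Q \<alpha> l zs \<longleftrightarrow>
    (let \<delta> = delta_l Q l;
         h = ev (digit (Q l) f (\<delta> - 1)) / (of_nat \<delta> * ev (digit (Q l) f \<delta>));
         bound = nu_l_plus Q l - nu_l Q l + val (Q l)
     in zs \<noteq> [] \<and> (\<forall>z \<in> set zs. homogeneous_below Q \<alpha> l z) \<and>
        \<nu>' h = val (hd zs) \<and> sorted_wrt (<) (map val zs) \<and> val (last zs) < bound \<and>
        (\<exists>\<phi> w M c e.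
           h = ev (sum_list zs) + ev \<phi> + w \<and>
           finite M \<and> (\<forall>\<gamma> \<in> M. standard_monomial \<alpha> l \<gamma> \<and> bound \<le> val (monomial Q \<gamma> (c \<gamma>))) \<and>
           \<phi> = (\<Sum>\<gamma> \<in> M. monomial Q \<gamma> (c \<gamma>)) \<and>
           w = e * (ev (Q l) + h) \<and> 0 \<le> \<nu>' e))"

text \<open>\<open>N\<close> is the number of key polynomials added: the new indices are \<open>l \<oplus>\<^sub>i k\<close> with \<open>1 \<le> k \<le> N\<close>.\<close>

definition step_B :: "(idx \<Rightarrow> 'k poly) \<Rightarrow> (idx \<Rightarrow> nat) \<Rightarrow> idx \<Rightarrow> enat \<Rightarrow> bool"
  where "step_B Q \<alpha> l N \<longleftrightarrow>
    (\<forall>k\<ge>1. enat k \<le> N \<longrightarrow> \<alpha> (l \<oplus>\<^sub>i k) = 1) \<and>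
    (if CHAR('k) = 0 then
       \<exists>zs. char_zero_decomposition Q \<alpha> l zs \<and>
         N = enat (Max {k. k \<le> length zs \<and> T_seq Q \<alpha> l (take k zs)}) \<and>
         (\<forall>k\<ge>1. enat k \<le> N \<longrightarrow> Q (l \<oplus>\<^sub>i k) = Q l + sum_list (take k zs))
     else if \<exists>q. T_maximal Q \<alpha> l q then
       \<exists>zs. T_seq Q \<alpha> l zs \<and> T_maximal Q \<alpha> l (Q l + sum_list zs) \<and>
         N = enat (length zs) \<and>
         (\<forall>k\<ge>1. enat k \<le> N \<longrightarrow> Q (l \<oplus>\<^sub>i k) = Q l + sum_list (take k zs))
     else
       N = \<infinity> \<and>
       (\<exists>z. (\<forall>t. T_seq Q \<alpha> l (map z [0..<Suc t])) \<and>
         (\<lambda>t. val (Q l + (\<Sum>k\<le>t. z k))) \<longlonglongrightarrow> (SUP q \<in> T Q \<alpha> l. val q) \<and>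
         (\<forall>t\<ge>1. Q (l \<oplus>\<^sub>i t) = Q l + (\<Sum>k<t. z k))))"

definition step :: "(idx \<Rightarrow> 'k poly) \<Rightarrow> (idx \<Rightarrow> nat) \<Rightarrow> idx \<Rightarrow> enat \<Rightarrow> bool"
  where "step Q \<alpha> l N \<longleftrightarrow>
    standard_expansion Q \<alpha> l (Q l) f \<and>
    (let R = G\<lparr>carrier := G_less Q l\<rparr> in
     \<exists>F g. monic_factorization R (in_l Q l) F \<and> g \<in> F \<and>
       is_minimal_polynomial G (G_less Q l) (init (Q l)) g \<and>
       (if (card F, deg R g) \<noteq> (1, 1)
        then N = 1 \<and> \<alpha> (l \<oplus>\<^sub>i 1) = deg R g \<and> lifting Q \<alpha> l g (Q (l \<oplus>\<^sub>i 1))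
        else step_B Q \<alpha> l N))"


subsection \<open>Step (C)\<close>

definition limit_candidate ::
    "(idx \<Rightarrow> 'k poly) \<Rightarrow> (idx \<Rightarrow> nat) \<Rightarrow> idx \<Rightarrow> ereal \<Rightarrow> nat \<Rightarrow> 'k poly \<Rightarrow> bool"
  where "limit_candidate Q \<alpha> l \<beta> e q \<longleftrightarrow>
    (\<exists>t. let i = l \<oplus>\<^sub>i t in
       weakly_affine_expansion Q \<alpha> i q \<and>
       digit (Q i) q (CHAR('k) ^ e) = 1 \<and> (\<forall>j > CHAR('k) ^ e. digit (Q i) q j = 0) \<and>
       \<beta> \<le> ereal (1 / real (CHAR('k) ^ e)) * val q)"

definition limit_step :: "(idx \<Rightarrow> 'k poly) \<Rightarrow> (idx \<Rightarrow> nat) \<Rightarrow> nat \<Rightarrow> bool"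
  where "limit_step Q \<alpha> a \<longleftrightarrow>
    (\<exists>b \<delta> e u e\<^sub>0 \<beta>. let l = (a, b); p = CHAR('k) in
       first_idx \<le> l \<and> (\<forall>t>0. \<alpha> (l \<oplus>\<^sub>i t) = 1) \<and> (\<forall>t. delta_l Q (l \<oplus>\<^sub>i t) = \<delta>) \<and>
       \<delta> = p ^ e * u \<and> \<not> p dvd u \<and>
       (\<lambda>t. val (Q (l \<oplus>\<^sub>i t))) \<longlonglongrightarrow> \<beta> \<and>
       1 \<le> e\<^sub>0 \<and> e\<^sub>0 \<le> e \<and>
       limit_candidate Q \<alpha> l \<beta> e\<^sub>0 (Q (add_omega l)) \<and>
       (\<forall>e'. 1 \<le> e' \<and> e' < e\<^sub>0 \<longrightarrow> (\<nexists>q. limit_candidate Q \<alpha> l \<beta> e' q)) \<and>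
       \<alpha> (add_omega l) = p ^ e\<^sub>0)"


subsection \<open>The construction\<close>

text \<open>
  A run is recorded by \<open>Q\<close>, \<open>\<alpha>\<close> and the number \<open>N l\<close> of key polynomials added when step (A) or (B)
  is carried out at \<open>l\<close>.  \<open>stage\<close> collects the indices \<open>l\<close> at which the construction looks for the next
  step, \<open>produced\<close> the indices of all key polynomials.  A stage with $Q_l = 0$ in $L$ has no
  continuation; an infinite sequence is continued only in positive characteristic and when its
  values do not tend to infinity.
\<close>

inductive stage and produced :: "(idx \<Rightarrow> 'k poly) \<Rightarrow> (idx \<Rightarrow> enat) \<Rightarrow> idx \<Rightarrow> bool"
  for Q :: "idx \<Rightarrow> 'k poly" and N :: "idx \<Rightarrow> enat"
  where
    start: "stage Q N first_idx"
  | continue: "stage Q N l \<Longrightarrow> ev (Q l) \<noteq> 0 \<Longrightarrow> N l = enat r \<Longrightarrow> stage Q N (l \<oplus>\<^sub>i r)"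
  | limit: "(\<And>b. first_idx \<le> (a, b) \<Longrightarrow> produced Q N (a, b)) \<Longrightarrow> CHAR('k) \<noteq> 0 \<Longrightarrow>
      \<not> (\<lambda>b. val (Q (a, b))) \<longlonglongrightarrow> \<infinity> \<Longrightarrow> stage Q N (Suc a, 0)"
  | stage: "stage Q N l \<Longrightarrow> produced Q N l"
  | new: "stage Q N l \<Longrightarrow> ev (Q l) \<noteq> 0 \<Longrightarrow> enat k \<le> N l \<Longrightarrow> produced Q N (l \<oplus>\<^sub>i k)"

definition key_polynomials :: "idx set \<Rightarrow> (idx \<Rightarrow> 'k poly) \<Rightarrow> (idx \<Rightarrow> nat) \<Rightarrow> bool"
  where "key_polynomials \<Lambda> Q \<alpha> \<longleftrightarrow>
    (\<exists>N. Q first_idx = [:0, 1:] \<and> \<alpha> first_idx = 1 \<and>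
       (\<forall>l. stage Q N l \<and> ev (Q l) \<noteq> 0 \<longrightarrow> step Q \<alpha> l (N l)) \<and>
       (\<forall>a. stage Q N (Suc a, 0) \<longrightarrow> limit_step Q \<alpha> a) \<and>
       \<Lambda> = {i. produced Q N i})"

end

end

theory Submission
  imports Defs
begin

text \<open>
  In characteristic zero no index with a positive first component is ever reached, because an
  infinite sequence of key polynomials ends the construction; the second component then embeds the
  index set into the natural numbers.

  In characteristic \<open>p > 0\<close> the point is that each limit step multiplies the degree of the key
  polynomials by at least \<open>p\<close>, while these degrees never exceed $n = \deg f$.  Along a run every key
  polynomial is monic and its degree is the product of the preceding $\alpha_j$
  (\<open>monic_tower\<close>), since whatever is added to a power of $Q_l$ is a combination of standard
  monomials, and these have smaller degree than $Q_l$ (\<open>standard_index_degree_less\<close>).  The bound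
  by \<open>n\<close> is preserved by every step.  In step (A) the factor $g_{1l}$ divides
  $\mathrm{in}_l f$, whose degree in $\bar Q_l$ is at most $n / \deg Q_l$
  (\<open>monic_factor_degree_le\<close>); step (B) does not change the degree; in the limit step the factor
  $p^{e_0}$ divides $\delta_l(f)$, and $\delta_l(f) \deg Q_l \le n$
  (\<open>delta_l_mult_degree_le\<close>).  So an index $\omega a + b$ can only occur if
  $p^a \le \deg f \le [L:K]$, that is, $a \le [\log_p n]$ (\<open>produced_degree_bounds\<close>), and a strictly
  increasing map between well-orders bounds the order type (\<open>strict_mono_imp_ordLeq\<close>).

  For the last estimate in the limit step, $Q_l$ must be non-zero in \<open>L\<close>.  One can choose such an
  \<open>l\<close> because two consecutive key polynomials are never both zero there
  (\<open>consecutive_not_both_0\<close>).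
\<close>

section \<open>Order types of sets of indices\<close>

lemma Field_order_on_idx: "Field (order_on_idx A) = A"
  by (auto simp: order_on_idx_def Field_def)

lemma Well_order_order_on_idx: "Well_order (order_on_idx A)"
proof -
  have "order_on_idx A - Id \<subseteq> {(x, y). x < y}"
    by (auto simp: order_on_idx_def)
  then have "wf (order_on_idx A - Id)"
    by (rule wf_subset[OF wf])
  moreover have "Linear_order (order_on_idx A)"
    unfolding linear_order_on_def partial_order_on_def preorder_on_def Field_order_on_idx
    by (auto simp: order_on_idx_def refl_on_def trans_def antisym_def total_on_def)
  ultimately show ?thesis
    by (simp add: well_order_on_def Field_order_on_idx)
qed

text \<open>
  If the target were shorter, it would embed below some element of \<open>A\<close>, and the composite would be
  a strictly increasing self-map of \<open>A\<close> moving a point down; the least such point is moved down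
  again to a smaller one.
\<close>

lemma strict_mono_imp_ordLeq:
  fixes h :: "idx \<Rightarrow> 'b"
  assumes wo: "Well_order s"
    and into: "\<And>i. i \<in> A \<Longrightarrow> h i \<in> Field s"
    and mono: "\<And>i j. i \<in> A \<Longrightarrow> j \<in> A \<Longrightarrow> i < j \<Longrightarrow> (h i, h j) \<in> s \<and> h i \<noteq> h j"
  shows "order_on_idx A \<le>o s"
proof (rule ccontr)
  assume "\<not> order_on_idx A \<le>o s"
  then have "s <o order_on_idx A"
    using not_ordLeq_iff_ordLess[OF wo Well_order_order_on_idx] by blast
  then obtain g where g: "embedS s (order_on_idx A) g"
    by (auto simp: ordLess_def)
  then have emb: "embed s (order_on_idx A) g" and nbij: "\<not> bij_betw g (Field s) A"
    by (auto simp: embedS_def Field_order_on_idx)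
  have gA: "g y \<in> A" if "y \<in> Field s" for y
    using embed_Field[OF emb] that by (auto simp: Field_order_on_idx)
  have inj: "inj_on g (Field s)"
    using embed_inj_on[OF wo emb] .
  have gmono: "g y < g z" if "(y, z) \<in> s" "y \<noteq> z" for y z
  proof -
    have yz: "y \<in> Field s" "z \<in> Field s"
      using that by (auto simp: Field_def)
    have "(g y, g z) \<in> order_on_idx A"
      using embed_compat[OF emb] that by (auto simp: compat_def)
    moreover have "g y \<noteq> g z"
      using inj that yz by (auto simp: inj_on_def)
    ultimately show ?thesis
      by (auto simp: order_on_idx_def)
  qed
  obtain a where a: "a \<in> A" "a \<notin> g ` Field s"
    using nbij inj gA by (auto simp: bij_betw_def)
  have ofil: "wo_rel.ofilter (order_on_idx A) (g ` Field s)"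
    using embed_Field_ofilter[OF wo Well_order_order_on_idx emb] .
  have down: "g y < a" if "y \<in> Field s" for y
  proof (rule ccontr)
    assume "\<not> g y < a"
    then have "(a, g y) \<in> order_on_idx A"
      using a(1) gA[OF that] by (auto simp: order_on_idx_def)
    then have "a \<in> under (order_on_idx A) (g y)"
      by (simp add: under_def)
    then show False
      using ofil a(2) that Well_order_order_on_idx
      by (auto simp: wo_rel.ofilter_def wo_rel_def)
  qed
  have "i \<in> A \<longrightarrow> \<not> g (h i) < i" for i
  proof (induction i rule: less_induct)
    case (less i)
    show ?case
    proof (intro impI notI)
      assume i: "i \<in> A" "g (h i) < i"
      have m: "g (h i) \<in> A"
        using gA into i by blast
      have "g (h (g (h i))) < g (h i)"
        using mono[OF m i(1) i(2)] gmono by blast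
      then show False
        using less m i by blast
    qed
  qed
  then show False
    using a(1) down[OF into[OF a(1)]] by blast
qed


section \<open>Expansions in powers of a monic polynomial\<close>

lemma div_power_step:
  fixes h q :: "'a::field poly"
  shows "h div q ^ j = q * (h div q ^ Suc j) + digit q h j"
  by (simp add: digit_def poly_div_mult_right mult.commute[of q] div_poly_eq_0_iff)

lemma div_power_eq_0_if_digits_eq_0:
  fixes h q :: "'a::field poly"
  assumes q: "0 < degree q" and z: "\<And>j. m \<le> j \<Longrightarrow> digit q h j = 0"
  shows "h div q ^ m = 0"
proof -
  have "h div q ^ m = q ^ k * (h div q ^ (m + k))" for k
  proof (induction k)
    case (Suc k)
    then show ?case
      using div_power_step[of h q "m + k"] z[of "m + k"] by (simp add: mult.assoc mult.left_commute)
  qed simp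
  moreover have "h div q ^ (m + Suc (degree h)) = 0"
  proof (rule div_poly_less)
    have "Suc (degree h) * 1 \<le> (m + Suc (degree h)) * degree q"
      using q by (intro mult_mono) auto
    then show "degree h < degree (q ^ (m + Suc (degree h)))"
      using q by (subst degree_power_eq) auto
  qed
  ultimately show ?thesis
    by (metis mult_zero_right)
qed

lemma digit_neq_0_imp_le:
  fixes h q :: "'a::field poly"
  assumes q: "0 < degree q" and d: "digit q h j \<noteq> 0"
  shows "j * degree q \<le> degree h"
proof (rule ccontr)
  assume "\<not> ?thesis"
  then have "degree h < degree (q ^ j)"
    using q by (subst degree_power_eq) auto
  then have "h div q ^ j = 0"
    by (rule div_poly_less)
  with d show False
    by (simp add: digit_def)
qed

lemma degree_lead_coeff_if_top_digit_1:
  fixes h q :: "'a::field poly"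
  assumes q: "0 < degree q" "lead_coeff q = 1"
    and top: "digit q h m = 1" and above: "\<And>j. m < j \<Longrightarrow> digit q h j = 0"
  shows "degree h = m * degree q \<and> lead_coeff h = 1"
proof -
  have "h div q ^ Suc m = 0"
    using div_power_eq_0_if_digits_eq_0[OF q(1), of "Suc m" h] above by simp
  then have "h div q ^ m = 1"
    using div_power_step[of h q m] top by simp
  then have h: "h = q ^ m + h mod q ^ m"
    using div_mult_mod_eq[of h "q ^ m"] by simp
  show ?thesis
  proof (cases "h mod q ^ m = 0")
    case True
    then show ?thesis
      using h q by (metis add.right_neutral degree_power_eq degree_0 lead_coeff_power less_irrefl power_one)
  next
    case False
    have "q ^ m \<noteq> 0"
      using q by auto
    then have lt: "degree (h mod q ^ m) < degree (q ^ m)"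
      using False degree_mod_less by blast
    have "degree h = degree (q ^ m)" "lead_coeff h = lead_coeff (q ^ m)"
      using h lt by (metis degree_add_eq_left, metis add.commute lead_coeff_add_le)
    moreover have "degree (q ^ m) = m * degree q"
      using q by (intro degree_power_eq) auto
    ultimately show ?thesis
      using q lead_coeff_power[of q m] by simp
  qed
qed


section \<open>Monic factors over a commutative ring with zero divisors\<close>

context UP_cring
begin

lemma monic_mult_nonzero:
  assumes g: "monic_up R g" and w: "w \<in> carrier P" "w \<noteq> \<zero>\<^bsub>P\<^esub>"
  shows "coeff P (g \<otimes>\<^bsub>P\<^esub> w) (deg R g + deg R w) \<noteq> \<zero>"
proof -
  have gP: "g \<in> carrier P"
    using g by (simp add: monic_up_def P_def)
  have g1: "coeff P g (deg R g) = \<one>"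
    using g gP by (simp add: monic_up_def UP_def P_def)
  let ?N = "deg R g + deg R w"
  have term0: "coeff P g i \<otimes> coeff P w (?N - i) = \<zero>" if "i \<noteq> deg R g" for i
  proof (cases "i < deg R g")
    case True
    then have "coeff P w (?N - i) = \<zero>"
      using w by (intro deg_aboveD) auto
    then show ?thesis
      using gP by simp
  next
    case False
    then have "coeff P g i = \<zero>"
      using that gP by (intro deg_aboveD) auto
    then show ?thesis
      using w by simp
  qed
  have "coeff P (g \<otimes>\<^bsub>P\<^esub> w) ?N = (\<Oplus>i \<in> {..?N}. coeff P g i \<otimes> coeff P w (?N - i))"
    using gP w by simp
  also have "\<dots> = (\<Oplus>i \<in> {..?N}. if deg R g = i then coeff P w (deg R w) else \<zero>)"
    using term0 g1 w gP by (intro R.finsum_cong') auto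
  also have "\<dots> = coeff P w (deg R w)"
    using w R.finsum_singleton[of "deg R g" "{..?N}" "\<lambda>_. coeff P w (deg R w)"] by simp
  finally show ?thesis
    using w lcoeff_nonzero2 by simp
qed

lemma monic_pow_mult_nonzero:
  assumes g: "monic_up R g" and w: "w \<in> carrier P" "w \<noteq> \<zero>\<^bsub>P\<^esub>"
  shows "g [^]\<^bsub>P\<^esub> (m::nat) \<otimes>\<^bsub>P\<^esub> w \<noteq> \<zero>\<^bsub>P\<^esub>"
proof (induction m)
  case (Suc m)
  have gP: "g \<in> carrier P"
    using g by (simp add: monic_up_def P_def)
  have "g [^]\<^bsub>P\<^esub> Suc m \<otimes>\<^bsub>P\<^esub> w = g \<otimes>\<^bsub>P\<^esub> (g [^]\<^bsub>P\<^esub> m \<otimes>\<^bsub>P\<^esub> w)"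
    using gP w by (simp add: P.m_ac)
  then show ?case
    using monic_mult_nonzero[OF g, of "g [^]\<^bsub>P\<^esub> m \<otimes>\<^bsub>P\<^esub> w"] Suc gP w
    by (metis P.m_closed P.nat_pow_closed coeff_zero)
qed (use w in simp)

lemma monic_finprod_mult_nonzero:
  assumes "finite F" and "\<And>g. g \<in> F \<Longrightarrow> monic_up R g" and w: "w \<in> carrier P" "w \<noteq> \<zero>\<^bsub>P\<^esub>"
  shows "(\<Otimes>\<^bsub>P\<^esub>g \<in> F. g [^]\<^bsub>P\<^esub> (m g :: nat)) \<otimes>\<^bsub>P\<^esub> w \<noteq> \<zero>\<^bsub>P\<^esub>"
  using assms(1,2)
proof (induction F)
  case (insert g F)
  have P: "\<And>k. k \<in> insert g F \<Longrightarrow> k \<in> carrier P"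
    using insert.prems by (simp add: monic_up_def P_def)
  then have "(\<Otimes>\<^bsub>P\<^esub>g \<in> insert g F. g [^]\<^bsub>P\<^esub> m g) \<otimes>\<^bsub>P\<^esub> w =
      g [^]\<^bsub>P\<^esub> m g \<otimes>\<^bsub>P\<^esub> ((\<Otimes>\<^bsub>P\<^esub>g \<in> F. g [^]\<^bsub>P\<^esub> m g) \<otimes>\<^bsub>P\<^esub> w)"
    using insert.hyps w by (subst P.finprod_insert) (auto simp: P.m_assoc)
  then show ?case
    using monic_pow_mult_nonzero[of g] insert P w by auto
qed (use w in simp)

lemma irreducible_monic_deg_pos:
  assumes g: "monic_up R g" and irr: "ring_irreducible\<^bsub>P\<^esub> g"
  shows "0 < deg R g"
proof (rule ccontr)
  assume "\<not> 0 < deg R g"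
  then have d: "deg R g = 0"
    by simp
  have gP: "g \<in> carrier P"
    using g by (simp add: monic_up_def P_def)
  have "coeff P g 0 = \<one>"
    using g gP d by (simp add: monic_up_def UP_def P_def)
  then have "g = monom P \<one> 0"
    using deg_zero_impl_monom[OF gP d] by simp
  then have "g = \<one>\<^bsub>P\<^esub>"
    by simp
  then show False
    using irr by (auto simp: ring_irreducible_def irreducible_def)
qed

end

text \<open>
  Since a monic factor cannot annihilate the leading coefficient of its cofactor, its degree is
  bounded although the coefficient ring need not be a domain.
\<close>

lemma monic_factorization_coeff_nonzero:
  fixes R :: "'c ring" (structure)
  assumes "cring R" and F: "monic_factorization R h F" and g: "g \<in> F"
  shows "\<exists>N \<ge> deg R g. h N \<noteq> \<zero>"
proof -
  interpret UP_cring R "UP R"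
    using assms(1) by (simp add: UP_cring_def)
  obtain c m where c: "c \<in> carrier R" "c \<noteq> \<zero>" and m: "\<forall>g \<in> F. 1 \<le> (m g :: nat)"
    and h: "h = monom (UP R) c 0 \<otimes>\<^bsub>UP R\<^esub> (\<Otimes>\<^bsub>UP R\<^esub>g \<in> F. g [^]\<^bsub>UP R\<^esub> m g)"
    and fin: "finite F" and mon: "\<And>g. g \<in> F \<Longrightarrow> monic_up R g"
    using F unfolding monic_factorization_def by blast
  have FP: "\<And>k. k \<in> F \<Longrightarrow> k \<in> carrier (UP R)"
    using mon by (simp add: monic_up_def)
  obtain k where k: "m g = Suc k"
    using m g by (metis not0_implies_Suc not_one_le_zero)
  define V where "V = (\<Otimes>\<^bsub>UP R\<^esub>k \<in> F - {g}. k [^]\<^bsub>UP R\<^esub> m k)"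
  define w where "w = g [^]\<^bsub>UP R\<^esub> k \<otimes>\<^bsub>UP R\<^esub> (V \<otimes>\<^bsub>UP R\<^esub> monom (UP R) c 0)"
  have VP: "V \<in> carrier (UP R)"
    unfolding V_def by (rule P.finprod_closed) (use FP in auto)
  have mP: "monom (UP R) c 0 \<in> carrier (UP R)"
    using c by simp
  have m0: "monom (UP R) c 0 \<noteq> \<zero>\<^bsub>UP R\<^esub>"
  proof
    assume "monom (UP R) c 0 = \<zero>\<^bsub>UP R\<^esub>"
    then have "coeff (UP R) (monom (UP R) c 0) 0 = \<zero>"
      by simp
    then show False
      using c by simp
  qed
  have V0: "V \<otimes>\<^bsub>UP R\<^esub> monom (UP R) c 0 \<noteq> \<zero>\<^bsub>UP R\<^esub>"
    unfolding V_def using fin mon mP m0 by (intro monic_finprod_mult_nonzero) auto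
  have w0: "w \<noteq> \<zero>\<^bsub>UP R\<^esub>"
    unfolding w_def using mon[OF g] V0 VP mP by (intro monic_pow_mult_nonzero) auto
  have wP: "w \<in> carrier (UP R)"
    unfolding w_def using FP[OF g] VP mP by auto
  have "(\<Otimes>\<^bsub>UP R\<^esub>g \<in> F. g [^]\<^bsub>UP R\<^esub> m g) = g [^]\<^bsub>UP R\<^esub> m g \<otimes>\<^bsub>UP R\<^esub> V"
  proof -
    have "(\<Otimes>\<^bsub>UP R\<^esub>g \<in> insert g (F - {g}). g [^]\<^bsub>UP R\<^esub> m g) = g [^]\<^bsub>UP R\<^esub> m g \<otimes>\<^bsub>UP R\<^esub> V"
      unfolding V_def using fin FP g by (intro P.finprod_insert) auto
    then show ?thesis
      using g by (simp add: insert_absorb)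
  qed
  then have hw: "h = g \<otimes>\<^bsub>UP R\<^esub> w"
    using h k w_def FP[OF g] VP mP by (simp add: P.m_ac)
  have "coeff (UP R) h (deg R g + deg R w) \<noteq> \<zero>"
    unfolding hw using monic_mult_nonzero[OF mon[OF g] wP w0] .
  moreover have "h \<in> carrier (UP R)"
    using hw FP[OF g] wP by simp
  then have "coeff (UP R) h = h"
    by (simp add: UP_def)
  ultimately show ?thesis
    by (metis le_add1)
qed


section \<open>The graded algebra is a commutative ring\<close>

context
  fixes v :: "'a::field \<Rightarrow> ereal"
  assumes v: "valuation v"
begin

lemma valuation_0: "v 0 = \<infinity>"
  using v by (simp add: valuation_def)

lemma valuation_eq_infinity_iff: "v y = \<infinity> \<longleftrightarrow> y = 0"
  using v by (simp add: valuation_def)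

lemma valuation_mult: "v (y * z) = v y + v z"
  using v by (simp add: valuation_def)

lemma valuation_not_MInf: "v y \<noteq> -\<infinity>"
  using v by (simp add: valuation_def)

lemma valuation_1: "v 1 = 0"
proof -
  have "v 1 = v 1 + v 1"
    using valuation_mult[of 1 1] by simp
  then show ?thesis
    using valuation_eq_infinity_iff[of 1] valuation_not_MInf[of 1] by (cases "v 1") auto
qed

lemma valuation_uminus: "v (- y) = v y"
proof -
  have "v (-1) + v (-1) = 0"
    using valuation_mult[of "-1" "-1"] valuation_1 by simp
  then have "v (-1) = 0"
    by (cases "v (-1)") (auto simp: zero_ereal_def)
  then show ?thesis
    using valuation_mult[of "-1" y] by simp
qed

lemma valuation_add_ge: "b \<le> v y \<Longrightarrow> b \<le> v z \<Longrightarrow> b \<le> v (y + z)"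
  using v by (meson min.boundedI order_trans valuation_def)

lemma valuation_add_gt: "b < v y \<Longrightarrow> b < v z \<Longrightarrow> b < v (y + z)"
  using v by (meson min_less_iff_conj less_le_trans valuation_def)

lemma valuation_Sum_any_ge:
  assumes "\<And>i. b \<le> v (g i)"
  shows "b \<le> v (Sum_any g)"
proof -
  have "b \<le> v (sum g A)" for A
    by (induction A rule: infinite_finite_induct) (auto simp: valuation_0 assms valuation_add_ge)
  then show ?thesis
    by (simp add: Sum_any.expand_set)
qed

lemma valuation_Sum_any_gt:
  assumes "\<And>i. b < v (g i)"
  shows "b < v (Sum_any g)"
proof -
  have "b < \<infinity>"
    using assms by (metis ereal_infty_less(1) not_less_iff_gr_or_eq order_less_trans)
  then have "b < v (sum g A)" for A
    by (induction A rule: infinite_finite_induct) (auto simp: valuation_0 assms valuation_add_gt)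
  then show ?thesis
    by (simp add: Sum_any.expand_set)
qed

lemma valuation_lookup_mult_ge:
  assumes "\<And>\<beta>. ereal \<beta> \<le> v (Poly_Mapping.lookup u \<beta>)" "\<And>\<beta>. ereal \<beta> \<le> v (Poly_Mapping.lookup w \<beta>)"
  shows "ereal \<beta> \<le> v (Poly_Mapping.lookup (u * w) \<beta>)"
  unfolding lookup_mult
proof (rule valuation_Sum_any_ge)
  fix l
  have "ereal (\<beta> - l) \<le> v (\<Sum>q. Poly_Mapping.lookup w q when \<beta> = l + q)"
    using assms(2) by (intro valuation_Sum_any_ge) (auto simp: when_def valuation_0)
  with assms(1)[of l] have "ereal l + ereal (\<beta> - l) \<le>
      v (Poly_Mapping.lookup u l) + v (\<Sum>q. Poly_Mapping.lookup w q when \<beta> = l + q)"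
    by (rule add_mono)
  then show "ereal \<beta> \<le> v (Poly_Mapping.lookup u l * (\<Sum>q. Poly_Mapping.lookup w q when \<beta> = l + q))"
    by (simp add: valuation_mult)
qed

lemma valuation_lookup_mult_gt:
  assumes "\<And>\<beta>. ereal \<beta> < v (Poly_Mapping.lookup u \<beta>)" "\<And>\<beta>. ereal \<beta> \<le> v (Poly_Mapping.lookup w \<beta>)"
  shows "ereal \<beta> < v (Poly_Mapping.lookup (u * w) \<beta>)"
  unfolding lookup_mult
proof (rule valuation_Sum_any_gt)
  fix l
  have "ereal (\<beta> - l) \<le> v (\<Sum>q. Poly_Mapping.lookup w q when \<beta> = l + q)"
    using assms(2) by (intro valuation_Sum_any_ge) (auto simp: when_def valuation_0)
  with assms(1)[of l] have "ereal l + ereal (\<beta> - l) <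
      v (Poly_Mapping.lookup u l) + v (\<Sum>q. Poly_Mapping.lookup w q when \<beta> = l + q)"
    by (cases "v (Poly_Mapping.lookup u l)"; cases "v (\<Sum>q. Poly_Mapping.lookup w q when \<beta> = l + q)") auto
  then show "ereal \<beta> < v (Poly_Mapping.lookup u l * (\<Sum>q. Poly_Mapping.lookup w q when \<beta> = l + q))"
    by (simp add: valuation_mult)
qed

lemma valuation_lookup_one: "ereal \<beta> \<le> v (Poly_Mapping.lookup 1 \<beta>)"
  by (simp add: lookup_one when_def valuation_0 valuation_1)

lemma cring_P_sum: "cring (P_sum v)"
proof (rule cringI)
  show "abelian_group (P_sum v)"
  proof (rule abelian_groupI)
    fix u assume "u \<in> carrier (P_sum v)"
    then show "\<exists>w \<in> carrier (P_sum v). w \<oplus>\<^bsub>P_sum v\<^esub> u = \<zero>\<^bsub>P_sum v\<^esub>"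
      by (intro bexI[of _ "- u"]) (auto simp: P_sum_def valuation_uminus)
  qed (auto simp: P_sum_def valuation_0 lookup_add intro: valuation_add_ge)
  show "comm_monoid (P_sum v)"
    by (rule comm_monoidI)
       (auto simp: P_sum_def valuation_lookup_one mult.assoc mult.commute intro: valuation_lookup_mult_ge)
qed (auto simp: P_sum_def distrib_right)

lemma ideal_P_plus_sum: "ideal (P_plus_sum v) (P_sum v)"
proof -
  interpret P: cring "P_sum v"
    by (rule cring_P_sum)
  have sub: "P_plus_sum v \<subseteq> carrier (P_sum v)"
    by (auto simp: P_plus_sum_def P_sum_def intro: less_imp_le)
  have ainv: "\<ominus>\<^bsub>P_sum v\<^esub> u = - u" if "u \<in> carrier (P_sum v)" for u
    using that by (intro P.minus_equality) (auto simp: P_sum_def valuation_uminus)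
  have "subgroup (P_plus_sum v) (add_monoid (P_sum v))"
  proof (rule subgroup.intro)
    fix u assume u: "u \<in> P_plus_sum v"
    have "inv\<^bsub>add_monoid (P_sum v)\<^esub> u = - u"
      using ainv[of u] u sub by (auto simp: a_inv_def)
    then show "inv\<^bsub>add_monoid (P_sum v)\<^esub> u \<in> P_plus_sum v"
      using u by (auto simp: P_plus_sum_def valuation_uminus)
  qed (use sub in \<open>auto simp: P_plus_sum_def P_sum_def lookup_add valuation_0 intro: valuation_add_gt\<close>)
  then show ?thesis
    by (rule idealI[OF P.ring_axioms])
       (auto simp: P_plus_sum_def P_sum_def mult.commute intro: valuation_lookup_mult_gt)
qed

lemma cring_graded_algebra: "cring (graded_algebra v)"
  unfolding graded_algebra_def
  by (rule ideal.quotient_is_cring[OF ideal_P_plus_sum cring_P_sum])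

lemma carrier_graded_algebraI:
  "u \<in> carrier (P_sum v) \<Longrightarrow> P_plus_sum v +>\<^bsub>P_sum v\<^esub> u \<in> carrier (graded_algebra v)"
  by (auto simp: graded_algebra_def FactRing_def A_RCOSETS_def')

lemma initial_form_closed: "initial_form v y \<in> carrier (graded_algebra v)"
proof -
  have "ereal (real_of_ereal (v y)) = v y" if "y \<noteq> 0"
    using that valuation_not_MInf[of y] valuation_eq_infinity_iff[of y] by (cases "v y") auto
  then have "Poly_Mapping.single (real_of_ereal (v y)) y \<in> carrier (P_sum v)"
    by (cases "y = 0") (auto simp: P_sum_def lookup_single when_def valuation_0)
  then show ?thesis
    unfolding initial_form_def by (rule carrier_graded_algebraI)
qed

lemma initial_form_0: "initial_form v 0 = \<zero>\<^bsub>graded_algebra v\<^esub>"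
proof -
  interpret ideal "P_plus_sum v" "P_sum v"
    by (rule ideal_P_plus_sum)
  have "P_plus_sum v +>\<^bsub>P_sum v\<^esub> \<zero>\<^bsub>P_sum v\<^esub> = P_plus_sum v"
    by (rule a_coset_add_zero[OF a_subset])
  then show ?thesis
    by (simp add: initial_form_def graded_algebra_def FactRing_def P_sum_def)
qed

lemma graded_subalgebra_subset: "graded_subalgebra \<iota> v \<subseteq> carrier (graded_algebra v)"
  by (auto simp: graded_subalgebra_def intro: carrier_graded_algebraI)

end


section \<open>Degrees of standard monomials\<close>

lemma idx_cases:
  assumes "first_idx \<le> i"
  obtains (first) "i = first_idx"
  | (succ) a b where "i = (a, b) \<oplus>\<^sub>i 1" "first_idx \<le> (a, b)"
  | (lim) a where "i = (Suc a, 0)"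
proof (cases "snd i")
  case 0
  then show ?thesis
    using assms lim[of "fst i - 1"] by (cases i; cases "fst i") (auto simp: first_idx_def)
next
  case (Suc b)
  show ?thesis
  proof (cases "i = first_idx")
    case False
    then show ?thesis
      using assms Suc succ[of "fst i" b]
      by (cases i) (auto simp: first_idx_def idx_add_def less_eq_prod_def)
  qed (rule first)
qed

text \<open>
  What the construction guarantees about the key polynomials up to \<open>l\<close>, as far as degrees are
  concerned.  At a limit index the degree is compared with that of some $Q_{(a,b)}$ beyond which all
  $\alpha$ in the block are \<open>1\<close>, so that the choice of \<open>b\<close> does not matter.
\<close>

definition monic_tower :: "(idx \<Rightarrow> 'k::field poly) \<Rightarrow> (idx \<Rightarrow> nat) \<Rightarrow> idx \<Rightarrow> bool"
  where "monic_tower Q \<alpha> l \<longleftrightarrow>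
    degree (Q first_idx) = 1 \<and>
    (\<forall>i. first_idx \<le> i \<and> i \<le> l \<longrightarrow> lead_coeff (Q i) = 1 \<and> 1 \<le> \<alpha> i) \<and>
    (\<forall>i. first_idx \<le> i \<and> i \<oplus>\<^sub>i 1 \<le> l \<longrightarrow> degree (Q (i \<oplus>\<^sub>i 1)) = \<alpha> (i \<oplus>\<^sub>i 1) * degree (Q i)) \<and>
    (\<forall>a. (Suc a, 0) \<le> l \<longrightarrow>
      (\<exists>b. first_idx \<le> (a, b) \<and> (\<forall>t>0. \<alpha> ((a, b) \<oplus>\<^sub>i t) = 1) \<and>
           degree (Q (Suc a, 0)) = \<alpha> (Suc a, 0) * degree (Q (a, b))))"

lemma monic_tower_lead_coeff:
  "monic_tower Q \<alpha> l \<Longrightarrow> first_idx \<le> i \<Longrightarrow> i \<le> l \<Longrightarrow> lead_coeff (Q i) = 1"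
  unfolding monic_tower_def by blast

lemma monic_tower_alpha_pos:
  "monic_tower Q \<alpha> l \<Longrightarrow> first_idx \<le> i \<Longrightarrow> i \<le> l \<Longrightarrow> 1 \<le> \<alpha> i"
  unfolding monic_tower_def by blast

lemma monic_tower_degree_step:
  "monic_tower Q \<alpha> l \<Longrightarrow> first_idx \<le> i \<Longrightarrow> i \<oplus>\<^sub>i 1 \<le> l \<Longrightarrow>
    degree (Q (i \<oplus>\<^sub>i 1)) = \<alpha> (i \<oplus>\<^sub>i 1) * degree (Q i)"
  unfolding monic_tower_def by blast

lemma monic_tower_degree_const:
  assumes "monic_tower Q \<alpha> l" "first_idx \<le> i" "i \<oplus>\<^sub>i t \<le> l"
    and "\<And>s. 0 < s \<Longrightarrow> s \<le> t \<Longrightarrow> \<alpha> (i \<oplus>\<^sub>i s) = 1"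
  shows "degree (Q (i \<oplus>\<^sub>i t)) = degree (Q i)"
  using assms(3,4)
proof (induction t)
  case (Suc t)
  have e: "i \<oplus>\<^sub>i t \<oplus>\<^sub>i 1 = i \<oplus>\<^sub>i Suc t"
    by (simp add: idx_add_def)
  have "i \<oplus>\<^sub>i t \<le> i \<oplus>\<^sub>i Suc t" "i \<le> i \<oplus>\<^sub>i t"
    by (auto simp: idx_add_def less_eq_prod_def)
  then have le: "i \<oplus>\<^sub>i t \<le> l" "first_idx \<le> i \<oplus>\<^sub>i t"
    using Suc.prems(1) assms(2) by auto
  then have "degree (Q (i \<oplus>\<^sub>i t \<oplus>\<^sub>i 1)) = \<alpha> (i \<oplus>\<^sub>i t \<oplus>\<^sub>i 1) * degree (Q (i \<oplus>\<^sub>i t))"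
    using assms(1) Suc.prems(1) e unfolding monic_tower_def by metis
  then show ?case
    using Suc.IH[OF le(1)] Suc.prems(2) e by simp
qed (simp add: idx_add_def)

lemma monic_tower_degree_pos:
  assumes W: "monic_tower Q \<alpha> l"
  shows "first_idx \<le> i \<Longrightarrow> i \<le> l \<Longrightarrow> 0 < degree (Q i)"
proof (induction i rule: less_induct)
  case (less i)
  have \<alpha>: "1 \<le> \<alpha> i"
    using monic_tower_alpha_pos[OF W less.prems] .
  from less.prems(1) show ?case
  proof (cases rule: idx_cases)
    case first
    then show ?thesis
      using W by (simp add: monic_tower_def)
  next
    case (succ a b)
    have lt: "(a, b) < i"
      using succ by (auto simp: idx_add_def less_prod_def)
    then have "0 < degree (Q (a, b))"
      using less succ by (meson less_imp_le order_trans)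
    moreover have "degree (Q i) = \<alpha> i * degree (Q (a, b))"
      using W succ less.prems by (simp add: monic_tower_def)
    ultimately show ?thesis
      using \<alpha> by simp
  next
    case (lim a)
    then obtain b where b: "first_idx \<le> (a, b)" "degree (Q i) = \<alpha> i * degree (Q (a, b))"
      using W less.prems unfolding monic_tower_def by blast
    have "(a, b) < i"
      using lim by (auto simp: less_prod_def)
    then have "0 < degree (Q (a, b))"
      using less b by (meson less_imp_le order_trans)
    then show ?thesis
      using \<alpha> b by simp
  qed
qed

text \<open>
  The bounds $\gamma_i \le \alpha_{i+} - 1$ make the sum telescope, since
  $(\alpha_{i+} - 1) \deg Q_i = \deg Q_{i+} - \deg Q_i$.  The indices of an earlier block that lie
  beyond its last $\alpha \neq 1$ all have the same \<open>i+\<close> and the same degree; at most one of them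
  occurs in the monomial, so that together they count as a single step of the telescope.
\<close>

lemma standard_index_degree_less:
  assumes W: "monic_tower Q \<alpha> l" and l: "first_idx \<le> l" and \<gamma>: "standard_index n \<alpha> l \<gamma>"
  shows "(\<Sum>i \<in> {i. \<gamma> i \<noteq> 0 \<and> i < l}. \<gamma> i * degree (Q i)) < degree (Q l)"
proof -
  define S where "S i = (\<Sum>j \<in> {j. \<gamma> j \<noteq> 0 \<and> j < i}. \<gamma> j * degree (Q j))" for i
  have fin: "finite {j. \<gamma> j \<noteq> 0 \<and> R j}" for R
    using \<gamma> by (auto simp: standard_index_def intro: finite_subset)
  have supp: "first_idx \<le> j" if "\<gamma> j \<noteq> 0" for j
    using \<gamma> that by (auto simp: standard_index_def)
  have bound: "\<gamma> j < \<alpha> (succ_idx \<alpha> l j)" if "first_idx \<le> j" "j < l" for j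
    using \<gamma> that by (auto simp: standard_index_def)
  have uniq: "j = k"
    if "i \<in> {first_idx..<l}" "\<not> essential \<alpha> l i"
      "j \<in> {first_idx..<succ_idx \<alpha> l i}" "k \<in> {first_idx..<succ_idx \<alpha> l i}"
      "succ_idx \<alpha> l j = succ_idx \<alpha> l i" "succ_idx \<alpha> l k = succ_idx \<alpha> l i" "\<gamma> j \<noteq> 0" "\<gamma> k \<noteq> 0" for i j k
    using \<gamma> that unfolding standard_index_def by blast
  \<comment> \<open>Partial sums obey the bound only at indices whose predecessors in the block are essential: past
    the last $\alpha \neq 1$ of an earlier block $\deg Q_i$ stays constant while the sum may grow.\<close>
  have claim: "S i < degree (Q i)"
    if "first_idx \<le> i" "i \<le> l" "\<And>j. first_idx \<le> j \<Longrightarrow> j < i \<Longrightarrow> fst j = fst i \<Longrightarrow> essential \<alpha> l j" for i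
    using that
  proof (induction i rule: less_induct)
    case (less i)
    from less.prems(1) show ?case
    proof (cases rule: idx_cases)
      case first
      then have "{j. \<gamma> j \<noteq> 0 \<and> j < i} = {}"
        using supp by (auto simp: not_less)
      then show ?thesis
        unfolding S_def using monic_tower_degree_pos[OF W less.prems(1,2)] by (simp del: Collect_empty_eq)
    next
      case (succ a b)
      let ?j = "(a, b)"
      have lt: "?j < i"
        using succ by (auto simp: idx_add_def less_prod_def)
      then have j: "?j < l"
        using less.prems(2) by (rule order.strict_trans2)
      have ess: "essential \<alpha> l ?j"
        using less.prems(3)[of ?j] succ lt by (simp add: idx_add_def)
      have IH: "S ?j < degree (Q ?j)"
      proof (rule less.IH[OF lt])
        fix k assume k: "first_idx \<le> k" "k < ?j" "fst k = fst ?j"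
        have "k < i"
          using k(2) lt by (rule order.strict_trans)
        then show "essential \<alpha> l k"
          using less.prems(3)[of k] succ k by (auto simp: idx_add_def)
      qed (use succ j in auto)
      have g: "\<gamma> ?j < \<alpha> i"
        using bound[OF succ(2) j] ess succ by (simp add: succ_idx_def)
      have "{k. \<gamma> k \<noteq> 0 \<and> k < i} \<subseteq> insert ?j {k. \<gamma> k \<noteq> 0 \<and> k < ?j}"
        using succ by (auto simp: idx_add_def less_prod_def)
      then have "S i \<le> (\<Sum>k \<in> insert ?j {k. \<gamma> k \<noteq> 0 \<and> k < ?j}. \<gamma> k * degree (Q k))"
        unfolding S_def using fin by (intro sum_mono2) auto
      also have "\<dots> = \<gamma> ?j * degree (Q ?j) + S ?j"
        unfolding S_def using fin by (subst sum.insert) auto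
      also have "\<dots> < Suc (\<gamma> ?j) * degree (Q ?j)"
        using IH by simp
      also have "\<dots> \<le> \<alpha> i * degree (Q ?j)"
        using g by (intro mult_right_mono) auto
      also have "\<dots> = degree (Q i)"
        using W succ less.prems(2) by (simp add: monic_tower_def)
      finally show ?thesis .
    next
      case (lim a)
      obtain b0 where b0: "first_idx \<le> (a, b0)" "\<forall>t>0. \<alpha> ((a, b0) \<oplus>\<^sub>i t) = 1"
        and deg: "degree (Q i) = \<alpha> i * degree (Q (a, b0))"
        using W lim less.prems(2) unfolding monic_tower_def by blast
      have below: "(a, b) < l" for b
        using lim less.prems(2) by (auto simp: less_prod_def less_eq_prod_def)
      let ?E = "\<lambda>b. first_idx \<le> (a, b) \<and> \<not> essential \<alpha> l (a, b)"
      have noness: "\<alpha> (a, b + t) = 1" if "\<not> essential \<alpha> l (a, b)" "0 < t" "first_idx \<le> (a, b)" for b t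
      proof -
        have "\<not> 1 < \<alpha> (a, b + t)"
        proof
          assume "1 < \<alpha> (a, b + t)"
          then have "essential \<alpha> l (a, b)"
            unfolding essential_def using that(2) below by (intro conjI exI[of _ t]) (auto simp: idx_add_def)
          with that(1) show False ..
        qed
        moreover have "first_idx \<le> (a, b + t)"
          using that(3) by (auto simp: less_eq_prod_def first_idx_def)
        then have "1 \<le> \<alpha> (a, b + t)"
          using W below by (auto simp: monic_tower_def less_imp_le)
        ultimately show ?thesis
          by simp
      qed
      have "a \<noteq> fst l"
        using lim less.prems(2) by (auto simp: less_eq_prod_def)
      then have Eb0: "?E b0"
        using b0 by (auto simp: essential_def idx_add_def)
      define b where "b = (LEAST b. ?E b)"
      have Eb: "?E b" and bb0: "b \<le> b0"
        unfolding b_def using Eb0 by (rule LeastI, rule Least_le)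
      have min: "essential \<alpha> l (a, c)" if "c < b" "first_idx \<le> (a, c)" for c
        using not_less_Least[of c ?E] that by (auto simp: b_def)
      have IH: "S (a, b) < degree (Q (a, b))"
      proof (rule less.IH)
        fix k assume "first_idx \<le> k" "k < (a, b)" "fst k = fst (a, b)"
        then show "essential \<alpha> l k"
          using min[of "snd k"] by (cases k) (auto simp: less_prod_def)
      next
        show "(a, b) < i"
          using lim by (simp add: less_prod_def)
        show "first_idx \<le> (a, b)" "(a, b) \<le> l"
          using Eb less_imp_le[OF below[of b]] by simp_all
      qed
      have tail_deg: "degree (Q (a, c)) = degree (Q (a, b))" if "b \<le> c" for c
        using monic_tower_degree_const[OF W, of "(a, b)" "c - b"] Eb that below noness
        by (auto simp: idx_add_def less_imp_le)
      have tail: "first_idx \<le> (a, c) \<and> \<not> essential \<alpha> l (a, c) \<and> succ_idx \<alpha> l (a, c) = i" if "b \<le> c" for c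
      proof -
        have f: "first_idx \<le> (a, c)"
          using Eb that by (auto simp: less_eq_prod_def)
        have "\<alpha> (a, c + t) = 1" if "0 < t" for t
          using noness[of b "c - b + t"] Eb \<open>b \<le> c\<close> that by simp
        then have "\<not> essential \<alpha> l (a, c)"
          using \<open>a \<noteq> fst l\<close> by (auto simp: essential_def idx_add_def)
        then show ?thesis
          using f lim by (simp add: succ_idx_def add_omega_def)
      qed
      let ?T = "{k. \<gamma> k \<noteq> 0 \<and> (a, b) \<le> k \<and> k < i}"
      have Tform: "\<exists>c\<ge>b. k = (a, c)" if "k \<in> ?T" for k
        using that lim by (cases k) (auto simp: less_prod_def less_eq_prod_def)
      have T: "?T = {} \<or> (\<exists>k \<in> ?T. ?T = {k})"
      proof -
        have "j = k" if "j \<in> ?T" "k \<in> ?T" for j k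
        proof -
          have jk: "succ_idx \<alpha> l j = i" "succ_idx \<alpha> l k = i" "\<not> essential \<alpha> l j" "first_idx \<le> j" "first_idx \<le> k"
            using Tform[OF that(1)] Tform[OF that(2)] tail by auto
          moreover have "j \<in> {first_idx..<l}"
            using jk that less.prems(2) by auto
          ultimately show ?thesis
            using uniq[of j j k] that by simp
        qed
        then show ?thesis
          by blast
      qed
      have Tsum: "(\<Sum>k \<in> ?T. \<gamma> k * degree (Q k)) \<le> (\<alpha> i - 1) * degree (Q (a, b))"
        using T
      proof
        assume "\<exists>k \<in> ?T. ?T = {k}"
        then obtain k where k: "k \<in> ?T" "?T = {k}"
          by blast
        obtain c where c: "b \<le> c" "k = (a, c)"
          using Tform[OF k(1)] by blast
        have "\<gamma> k < \<alpha> i"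
          using bound[of k] tail[OF c(1)] c below by auto
        then have "\<gamma> k * degree (Q (a, b)) \<le> (\<alpha> i - 1) * degree (Q (a, b))"
          by (intro mult_right_mono) auto
        moreover have "(\<Sum>k \<in> ?T. \<gamma> k * degree (Q k)) = \<gamma> k * degree (Q (a, b))"
          by (subst k(2)) (simp add: c(2) tail_deg[OF c(1)])
        ultimately show ?thesis
          by simp
      qed (simp del: Collect_empty_eq)
      have \<alpha>: "1 \<le> \<alpha> i"
        using monic_tower_alpha_pos[OF W less.prems(1,2)] .
      have "{k. \<gamma> k \<noteq> 0 \<and> k < i} = {k. \<gamma> k \<noteq> 0 \<and> k < (a, b)} \<union> ?T"
        using lim by (auto simp: less_prod_def)
      then have "S i = S (a, b) + (\<Sum>k \<in> ?T. \<gamma> k * degree (Q k))"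
        unfolding S_def using fin by (simp only:) (subst sum.union_disjoint, auto)
      also have "\<dots> < degree (Q (a, b)) + (\<alpha> i - 1) * degree (Q (a, b))"
        using IH Tsum by simp
      also have "\<dots> = \<alpha> i * degree (Q (a, b))"
        using \<alpha> by (metis add.commute le_add_diff_inverse2 mult_Suc plus_1_eq_Suc)
      also have "\<dots> = degree (Q i)"
        using deg tail_deg[OF bb0] by simp
      finally show ?thesis .
    qed
  qed
  have "S l < degree (Q l)"
  proof (rule claim)
    fix j assume "first_idx \<le> j" "j < l" "fst j = fst l"
    then show "essential \<alpha> l j"
      by (cases j; cases l) (auto simp: essential_def idx_add_def less_prod_def intro!: exI[of _ "snd l - snd j"])
  qed (use l in auto)
  then show ?thesis
    by (simp add: S_def)
qed

lemma standard_monomial_degree_less: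
  assumes W: "monic_tower Q \<alpha> l" and l: "first_idx \<le> l"
    and \<gamma>: "standard_index n \<alpha> l \<gamma>" "\<gamma> l = 0"
  shows "degree (monomial Q \<gamma> c) < degree (Q l)"
proof -
  have fin: "finite {i. \<gamma> i \<noteq> 0}"
    using \<gamma> by (simp add: standard_index_def)
  have "degree (monomial Q \<gamma> c) \<le> degree (\<Prod>i \<in> {i. \<gamma> i \<noteq> 0}. Q i ^ \<gamma> i)"
    unfolding monomial_def by (rule degree_smult_le)
  also have "\<dots> \<le> (\<Sum>i \<in> {i. \<gamma> i \<noteq> 0}. degree (Q i ^ \<gamma> i))"
    using degree_prod_sum_le[OF fin] by (simp add: o_def)
  also have "\<dots> \<le> (\<Sum>i \<in> {i. \<gamma> i \<noteq> 0}. \<gamma> i * degree (Q i))"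
    by (intro sum_mono) (metis degree_power_le mult.commute)
  also have "{i. \<gamma> i \<noteq> 0} = {i. \<gamma> i \<noteq> 0 \<and> i < l}"
    using \<gamma> by (force simp: standard_index_def)
  finally show ?thesis
    using standard_index_degree_less[OF W l \<gamma>(1)] by simp
qed

lemma sum_standard_monomials_degree_less:
  assumes W: "monic_tower Q \<alpha> l" and l: "first_idx \<le> l"
    and M: "\<And>\<gamma>. \<gamma> \<in> M \<Longrightarrow> standard_index n \<alpha> l \<gamma> \<and> \<gamma> l = 0"
  shows "degree (\<Sum>\<gamma> \<in> M. monomial Q \<gamma> (c \<gamma>)) < degree (Q l)"
proof (rule degree_sum_less)
  show "degree (monomial Q \<gamma> (c \<gamma>)) < degree (Q l)" if "\<gamma> \<in> M" for \<gamma>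
    using standard_monomial_degree_less[OF W l] M[OF that] by blast
qed (use monic_tower_degree_pos[OF W l] in simp)


section \<open>Evaluation at the generator\<close>

context valued_extension
begin

lemma iota_0: "\<iota> 0 = 0"
  using embedding by (metis add_cancel_right_right field_embedding_def)

lemma ev_eq_sum:
  assumes "degree h \<le> m"
  shows "ev h = (\<Sum>i\<le>m. \<iota> (Polynomial.coeff h i) * x ^ i)"
proof -
  have "ev h = (\<Sum>i\<le>degree (map_poly \<iota> h). \<iota> (Polynomial.coeff h i) * x ^ i)"
    unfolding ev_def by (simp add: poly_altdef coeff_map_poly iota_0)
  also have "\<dots> = (\<Sum>i\<le>m. \<iota> (Polynomial.coeff h i) * x ^ i)"
  proof (rule sum.mono_neutral_left)
    have "degree (map_poly \<iota> h) \<le> m"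
      using assms by (intro degree_le) (simp add: coeff_map_poly iota_0 coeff_eq_0)
    then show "{..degree (map_poly \<iota> h)} \<subseteq> {..m}"
      by simp
    show "\<forall>i \<in> {..m} - {..degree (map_poly \<iota> h)}. \<iota> (Polynomial.coeff h i) * x ^ i = 0"
      by (metis DiffD2 atMost_iff coeff_eq_0 coeff_map_poly iota_0 mult_zero_left not_le)
  qed simp
  finally show ?thesis .
qed

lemma ev_0: "ev 0 = 0"
  by (simp add: ev_def)

lemma ev_add: "ev (g + h) = ev g + ev h"
proof -
  let ?m = "max (degree g) (degree h)"
  have "\<iota> (c + d) = \<iota> c + \<iota> d" for c d
    using embedding by (simp add: field_embedding_def)
  then show ?thesis
    using ev_eq_sum[of g ?m] ev_eq_sum[of h ?m] ev_eq_sum[of "g + h" ?m] degree_add_le_max[of g h]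
    by (simp add: distrib_right sum.distrib)
qed

lemma ev_neq_0: "h \<noteq> 0 \<Longrightarrow> degree h < degree f \<Longrightarrow> ev h \<noteq> 0"
  using min_poly_least[of h] by (auto simp: ev_def)

lemma degree_f_pos: "0 < degree f"
proof (rule ccontr)
  assume "\<not> 0 < degree f"
  then have "ev f = \<iota> (lead_coeff f)"
    using ev_eq_sum[of f 0] by simp
  also have "\<dots> = 1"
    using embedding min_poly_monic by (simp add: field_embedding_def)
  finally show False
    using min_poly_root by (simp add: ev_def)
qed

lemma val_eq_infinity_iff: "val h = \<infinity> \<longleftrightarrow> ev h = 0"
  using valuation by (simp add: val_def valuation_def)

lemma val_not_MInf: "val h \<noteq> -\<infinity>"
  using valuation by (simp add: val_def valuation_def)

text \<open>The powers $1, x, \dots, x^{\deg f - 1}$ are independent over the base field.\<close>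

lemma degree_le_extension_degree: "degree f \<le> extension_degree \<iota>"
proof -
  interpret vs: vector_space "\<lambda>c y. \<iota> c * y"
    using embedding by unfold_locales (auto simp: field_embedding_def algebra_simps)
  obtain B0 where B0: "finite B0" "vs.span B0 = UNIV"
    using finite_ext by (auto simp: finite_extension_def)
  obtain B where B: "B \<subseteq> B0" "vs.independent B" "B0 \<subseteq> vs.span B"
    using vs.maximal_independent_subset[of B0] by blast
  have spanB: "vs.span B = UNIV"
    using B(3) B0(2) by (metis top.extremum_uniqueI vs.span_minimal vs.subspace_span)
  interpret fd: finite_dimensional_vector_space "\<lambda>c y. \<iota> c * y" B
    using B spanB finite_subset[OF B(1) B0(1)] by unfold_locales auto
  have inj: "inj_on (\<lambda>i. x ^ i) {..<degree f}"
  proof (rule linorder_inj_onI')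
    fix i j assume ij: "i \<in> {..<degree f}" "j \<in> {..<degree f}" "i < j"
    let ?h = "Polynomial.monom 1 i + Polynomial.monom (-1) j :: 'k poly"
    have "Polynomial.coeff ?h j \<noteq> 0"
      using ij by simp
    then have "?h \<noteq> 0"
      by fastforce
    moreover have deg: "degree ?h < degree f"
      using ij by (intro degree_add_less le_less_trans[OF degree_monom_le]) auto
    ultimately have "ev ?h \<noteq> 0"
      by (rule ev_neq_0)
    moreover have "ev (Polynomial.monom c k) = \<iota> c * x ^ k" for c k
      by (simp add: ev_def map_poly_monom poly_monom iota_0)
    moreover have "\<iota> 1 = 1" "\<iota> (-1) = -1"
      using embedding iota_0 unfolding field_embedding_def
      by (auto, metis add.right_inverse add_eq_0_iff)
    ultimately show "x ^ i \<noteq> x ^ j"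
      by (simp add: ev_add)
  qed
  have "vs.independent ((\<lambda>i. x ^ i) ` {..<degree f})"
  proof (rule vs.independent_if_scalars_zero)
    fix u v assume u: "(\<Sum>y \<in> (\<lambda>i. x ^ i) ` {..<degree f}. \<iota> (u y) * y) = 0"
      and v: "v \<in> (\<lambda>i. x ^ i) ` {..<degree f}"
    define h where "h = (\<Sum>i<degree f. Polynomial.monom (u (x ^ i)) i)"
    have coeff: "Polynomial.coeff h i = (if i < degree f then u (x ^ i) else 0)" for i
      by (simp add: h_def coeff_sum)
    have deg: "degree h < degree f"
      using coeff degree_f_pos by (metis degree_0 leading_coeff_0_iff)
    have "ev h = (\<Sum>i\<le>degree f - 1. \<iota> (Polynomial.coeff h i) * x ^ i)"
      using deg by (intro ev_eq_sum) simp
    also have "{..degree f - 1} = {..<degree f}"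
      using degree_f_pos by auto
    also have "(\<Sum>i<degree f. \<iota> (Polynomial.coeff h i) * x ^ i) = (\<Sum>i<degree f. \<iota> (u (x ^ i)) * x ^ i)"
      by (intro sum.cong) (auto simp: coeff)
    also have "\<dots> = 0"
      using u by (simp add: sum.reindex[OF inj])
    finally have "h = 0"
      using ev_neq_0 deg by blast
    then show "u v = 0"
      using v coeff by (metis (mono_tags, lifting) coeff_0 imageE lessThan_iff)
  qed simp
  then have "card ((\<lambda>i. x ^ i) ` {..<degree f}) \<le> vs.dim (UNIV :: 'l set)"
    by (intro fd.independent_card_le_dim) auto
  then show ?thesis
    by (simp add: card_image[OF inj] extension_degree_def)
qed


section \<open>Degrees of key polynomials\<close>

lemma standard_sum_below_degree_less:
  assumes "monic_tower Q \<alpha> l" "first_idx \<le> l" "standard_sum_below Q \<alpha> l M c"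
  shows "degree (\<Sum>\<gamma> \<in> M. monomial Q \<gamma> (c \<gamma>)) < degree (Q l)"
  using assms(3)
  by (intro sum_standard_monomials_degree_less[OF assms(1,2), of _ "degree f"])
     (simp add: standard_sum_below_def standard_monomial_def)

lemma homogeneous_below_degree_less:
  "monic_tower Q \<alpha> l \<Longrightarrow> first_idx \<le> l \<Longrightarrow> homogeneous_below Q \<alpha> l d \<Longrightarrow> degree d < degree (Q l)"
  by (auto simp: homogeneous_below_def intro: standard_sum_below_degree_less)

lemma monic_add_lower:
  fixes q r :: "'k poly"
  assumes "lead_coeff q = 1" "degree r < degree q"
  shows "degree (q + r) = degree q \<and> lead_coeff (q + r) = 1"
  using assms by (simp add: degree_add_eq_left coeff_eq_0)

lemma T_seq_degree:
  assumes W: "monic_tower Q \<alpha> l" and l: "first_idx \<le> l" and T: "T_seq Q \<alpha> l zs"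
  shows "degree (Q l + sum_list (take k zs)) = degree (Q l) \<and> lead_coeff (Q l + sum_list (take k zs)) = 1"
proof (rule monic_add_lower)
  show "lead_coeff (Q l) = 1"
    using monic_tower_lead_coeff[OF W l order_refl] .
  have "degree z < degree (Q l)" if "z \<in> set (take k zs)" for z
    using T in_set_takeD[OF that] homogeneous_below_degree_less[OF W l] by (auto simp: T_seq_def)
  moreover have "degree (sum_list ys) < degree (Q l)"
    if "\<And>z. z \<in> set ys \<Longrightarrow> degree z < degree (Q l)" for ys :: "'k poly list"
    using that monic_tower_degree_pos[OF W l order_refl] by (induction ys) (auto intro: degree_add_less)
  ultimately show "degree (sum_list (take k zs)) < degree (Q l)"
    by blast
qed

text \<open>
  A later entry of \<open>zs\<close>, or the characteristic side of the whole sum, has a larger value, so no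
  entry has infinite value.
\<close>

lemma T_seq_ev_neq_0:
  assumes T: "T_seq Q \<alpha> l zs" and k: "k < length zs"
  shows "ev (zs ! k) \<noteq> 0"
proof -
  have ne: "zs \<noteq> []"
    using k by auto
  then obtain b where b: "val (last zs) < b"
    using T by (auto simp: T_seq_def)
  have s: "sorted_wrt (<) (map val zs)"
    using T ne by (auto simp: T_seq_def)
  have "val (zs ! k) \<le> val (last zs)"
  proof (cases "k = length zs - 1")
    case False
    then show ?thesis
      using s k ne sorted_wrt_nth_less[OF s, of k "length zs - 1"]
      by (simp add: last_conv_nth less_imp_le)
  qed (use ne in \<open>simp add: last_conv_nth\<close>)
  with b have "val (zs ! k) < \<infinity>"
    by (metis ereal_less_PInfty le_less_trans less_le_trans top_greatest top_ereal_def)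
  then show ?thesis
    using val_eq_infinity_iff by fastforce
qed

text \<open>
  A uniform description of both cases in positive characteristic.  When \<open>T\<close> has no maximal element,
  finite initial segments of the infinite sequence are enough, as only finitely many key polynomials
  are considered at a time.
\<close>

lemma step_B_T_seq:
  assumes B: "step_B Q \<alpha> l N" and p: "CHAR('k) > 0" and k: "enat k \<le> N"
  shows "\<exists>zs. T_seq Q \<alpha> l zs \<and> k \<le> length zs \<and>
    (\<forall>j. 1 \<le> j \<and> j \<le> k \<longrightarrow> \<alpha> (l \<oplus>\<^sub>i j) = 1 \<and> Q (l \<oplus>\<^sub>i j) = Q l + sum_list (take j zs))"
proof -
  have le: "enat j \<le> N" if "j \<le> k" for j
    using that k by (meson enat_ord_simps(1) order_trans)
  have \<alpha>: "\<alpha> (l \<oplus>\<^sub>i j) = 1" if "1 \<le> j" "j \<le> k" for j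
    using B le that by (auto simp: step_B_def)
  show ?thesis
  proof (cases "\<exists>q. T_maximal Q \<alpha> l q")
    case True
    then obtain zs where "T_seq Q \<alpha> l zs" "N = enat (length zs)"
        "\<forall>k\<ge>1. enat k \<le> N \<longrightarrow> Q (l \<oplus>\<^sub>i k) = Q l + sum_list (take k zs)"
      using B p by (auto simp: step_B_def)
    then show ?thesis
      using \<alpha> le k by (intro exI[of _ zs]) auto
  next
    case False
    then obtain z where T: "\<forall>t. T_seq Q \<alpha> l (map z [0..<Suc t])"
      and Q: "\<forall>t\<ge>1. Q (l \<oplus>\<^sub>i t) = Q l + (\<Sum>k<t. z k)"
      using B p unfolding step_B_def if_not_P[OF False] by auto
    have "sum_list (take j (map z [0..<Suc k])) = (\<Sum>i<j. z i)" if "j \<le> k" for j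
    proof -
      have "take j (map z [0..<Suc k]) = map z [0..<j]"
        using that by (simp add: take_map take_upt del: upt_Suc)
      then show ?thesis
        by (simp add: interv_sum_list_conv_sum_set_nat atLeast0LessThan)
    qed
    then show ?thesis
      using T Q \<alpha> by (intro exI[of _ "map z [0..<Suc k]"]) auto
  qed
qed

lemma cring_G_less: "cring (G\<lparr>carrier := G_less Q l\<rparr>)"
proof -
  interpret cring G
    unfolding G_def by (rule cring_graded_algebra[OF valuation])
  let ?H = "graded_subalgebra \<iota> \<nu>' \<union> (\<lambda>i. init (Q i)) ` {first_idx..<l}"
  have H: "?H \<subseteq> carrier G"
    using graded_subalgebra_subset[OF valuation] initial_form_closed[OF valuation]
    by (auto simp: G_def init_def)
  show ?thesis
    unfolding G_less_def
    using subcringI'[OF generate_ring_is_subring[OF H]] subcring_iff[OF generate_ring_incl[OF H]] by simp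
qed

lemma init_on_neq_0_imp_digit_neq_0: "init_on q h b j \<noteq> \<zero>\<^bsub>G\<^esub> \<Longrightarrow> digit q h j \<noteq> 0"
  by (auto simp: init_on_def init_def ev_0 G_def initial_form_0[OF valuation] split: if_splits)

text \<open>
  The initial form of zero is zero, so $\mathrm{in}_l f$ has no terms beyond the last non-zero
  coefficient of the expansion of \<open>f\<close>.
\<close>

lemma monic_factor_degree_le:
  assumes q: "0 < degree (Q l)"
    and F: "monic_factorization (G\<lparr>carrier := G_less Q l\<rparr>) (in_l Q l) F" "g \<in> F"
  shows "deg (G\<lparr>carrier := G_less Q l\<rparr>) g * degree (Q l) \<le> degree f"
proof -
  let ?R = "G\<lparr>carrier := G_less Q l\<rparr>"
  obtain j where j: "deg ?R g \<le> j" "in_l Q l j \<noteq> \<zero>\<^bsub>?R\<^esub>"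
    using monic_factorization_coeff_nonzero[OF cring_G_less F] by blast
  then have "digit (Q l) f j \<noteq> 0"
    unfolding in_l_def using init_on_neq_0_imp_digit_neq_0 by fastforce
  then have "j * degree (Q l) \<le> degree f"
    by (rule digit_neq_0_imp_le[OF q])
  then show ?thesis
    using j(1) by (meson mult_le_mono1 order_trans)
qed

lemma lifting_degree:
  assumes W: "monic_tower Q \<alpha> l" and l: "first_idx \<le> l" and q: "lifting Q \<alpha> l g q"
    and d: "0 < deg (G\<lparr>carrier := G_less Q l\<rparr>) g"
  shows "degree q = deg (G\<lparr>carrier := G_less Q l\<rparr>) g * degree (Q l) \<and> lead_coeff q = 1"
proof -
  let ?a = "deg (G\<lparr>carrier := G_less Q l\<rparr>) g"
  obtain M c where M: "\<And>j \<gamma>. j < ?a \<Longrightarrow> \<gamma> \<in> M j \<Longrightarrow> standard_index (degree f) \<alpha> l \<gamma> \<and> \<gamma> l = 0"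
    and q: "q = Q l ^ ?a + (\<Sum>j<?a. (\<Sum>\<gamma> \<in> M j. monomial Q \<gamma> (c j \<gamma>)) * Q l ^ j)"
    using q by (auto simp: lifting_def Let_def standard_monomial_def)
  have D: "0 < degree (Q l)" "lead_coeff (Q l) = 1"
    using monic_tower_degree_pos[OF W l order_refl] monic_tower_lead_coeff[OF W l order_refl] by simp_all
  have pow: "degree (Q l ^ j) = j * degree (Q l)" for j
    using D by (intro degree_power_eq) auto
  have "degree (\<Sum>j<?a. (\<Sum>\<gamma> \<in> M j. monomial Q \<gamma> (c j \<gamma>)) * Q l ^ j) < ?a * degree (Q l)"
  proof (rule degree_sum_less)
    fix j assume j: "j \<in> {..<?a}"
    have "degree (\<Sum>\<gamma> \<in> M j. monomial Q \<gamma> (c j \<gamma>)) < degree (Q l)"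
      using sum_standard_monomials_degree_less[OF W l, of "M j" "degree f"] M j by blast
    then have "degree ((\<Sum>\<gamma> \<in> M j. monomial Q \<gamma> (c j \<gamma>)) * Q l ^ j) < Suc j * degree (Q l)"
      using degree_mult_le[of "\<Sum>\<gamma> \<in> M j. monomial Q \<gamma> (c j \<gamma>)" "Q l ^ j"] pow by simp
    also have "\<dots> \<le> ?a * degree (Q l)"
      using j by (intro mult_right_mono) auto
    finally show "degree ((\<Sum>\<gamma> \<in> M j. monomial Q \<gamma> (c j \<gamma>)) * Q l ^ j) < ?a * degree (Q l)" .
  qed (use D d in simp)
  then have lower: "degree (\<Sum>j<?a. (\<Sum>\<gamma> \<in> M j. monomial Q \<gamma> (c j \<gamma>)) * Q l ^ j) < degree (Q l ^ ?a)"
    by (simp add: pow)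
  have monic: "lead_coeff (Q l ^ ?a) = 1"
    using D lead_coeff_power[of "Q l" ?a] by simp
  have "degree q = degree (Q l ^ ?a) \<and> lead_coeff q = 1"
    unfolding q by (rule monic_add_lower[OF monic lower])
  then show ?thesis
    unfolding pow .
qed

lemma monic_tower_extend:
  assumes W: "monic_tower Q \<alpha> l" and l: "first_idx \<le> l"
    and new: "\<And>j. 1 \<le> j \<Longrightarrow> j \<le> k \<Longrightarrow> lead_coeff (Q (l \<oplus>\<^sub>i j)) = 1 \<and> 1 \<le> \<alpha> (l \<oplus>\<^sub>i j) \<and>
      degree (Q (l \<oplus>\<^sub>i j)) = \<alpha> (l \<oplus>\<^sub>i j) * degree (Q (l \<oplus>\<^sub>i (j - 1)))"
  shows "monic_tower Q \<alpha> (l \<oplus>\<^sub>i k)"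
proof -
  have split: "i \<le> l \<or> (\<exists>j\<ge>1. j \<le> k \<and> i = l \<oplus>\<^sub>i j)" if "i \<le> l \<oplus>\<^sub>i k" for i
  proof (cases "i \<le> l")
    case False
    then have "fst i = fst l" "snd l < snd i" "snd i \<le> snd l + k"
      using that by (auto simp: less_eq_prod_def idx_add_def)
    then show ?thesis
      by (intro disjI2 exI[of _ "snd i - snd l"]) (auto simp: idx_add_def prod_eq_iff)
  qed simp
  have "degree (Q (i \<oplus>\<^sub>i 1)) = \<alpha> (i \<oplus>\<^sub>i 1) * degree (Q i)"
    if i: "first_idx \<le> i" "i \<oplus>\<^sub>i 1 \<le> l \<oplus>\<^sub>i k" for i
    using split[OF i(2)]
  proof
    assume "\<exists>j\<ge>1. j \<le> k \<and> i \<oplus>\<^sub>i 1 = l \<oplus>\<^sub>i j"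
    then obtain j where j: "1 \<le> j" "j \<le> k" "i \<oplus>\<^sub>i 1 = l \<oplus>\<^sub>i j"
      by blast
    then have "i = l \<oplus>\<^sub>i (j - 1)"
      by (auto simp: idx_add_def prod_eq_iff)
    then show ?thesis
      using new[OF j(1,2)] j(3) by simp
  qed (rule monic_tower_degree_step[OF W i(1)])
  moreover have "lead_coeff (Q i) = 1 \<and> 1 \<le> \<alpha> i" if i: "first_idx \<le> i" "i \<le> l \<oplus>\<^sub>i k" for i
    using split[OF i(2)] W i(1) new unfolding monic_tower_def by blast
  moreover have "(Suc a, 0) \<le> l" if "(Suc a, 0) \<le> l \<oplus>\<^sub>i k" for a
    using that by (auto simp: less_eq_prod_def idx_add_def)
  ultimately show ?thesis
    using W unfolding monic_tower_def by blast
qed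

lemma monic_tower_limit:
  assumes W: "\<And>b. first_idx \<le> (a, b) \<Longrightarrow> monic_tower Q \<alpha> (a, b)"
    and lim: "lead_coeff (Q (Suc a, 0)) = 1" "1 \<le> \<alpha> (Suc a, 0)"
    and b: "first_idx \<le> (a, b)" "\<forall>t>0. \<alpha> ((a, b) \<oplus>\<^sub>i t) = 1"
      "degree (Q (Suc a, 0)) = \<alpha> (Suc a, 0) * degree (Q (a, b))"
  shows "monic_tower Q \<alpha> (Suc a, 0)"
proof -
  have f: "first_idx \<le> (a, Suc c)" for c
    by (auto simp: first_idx_def less_eq_prod_def)
  have below: "i \<le> (a, Suc (snd i))" if "i < (Suc a, 0)" for i
    using that by (cases i) (auto simp: less_eq_prod_def less_prod_def)
  have "lead_coeff (Q i) = 1 \<and> 1 \<le> \<alpha> i" if i: "first_idx \<le> i" "i \<le> (Suc a, 0)" for i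
  proof (cases "i = (Suc a, 0)")
    case False
    then show ?thesis
      using below[of i] i W[OF f] unfolding monic_tower_def by (metis order_le_less)
  qed (use lim in simp)
  moreover have "degree (Q (i \<oplus>\<^sub>i 1)) = \<alpha> (i \<oplus>\<^sub>i 1) * degree (Q i)"
    if i: "first_idx \<le> i" "i \<oplus>\<^sub>i 1 \<le> (Suc a, 0)" for i
  proof -
    have "i \<oplus>\<^sub>i 1 < (Suc a, 0)"
      using i(2) by (auto simp: idx_add_def less_prod_def less_eq_prod_def)
    then show ?thesis
      using below[of "i \<oplus>\<^sub>i 1"] i W[OF f] unfolding monic_tower_def by metis
  qed
  moreover have "\<exists>b. first_idx \<le> (a', b) \<and> (\<forall>t>0. \<alpha> ((a', b) \<oplus>\<^sub>i t) = 1) \<and>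
      degree (Q (Suc a', 0)) = \<alpha> (Suc a', 0) * degree (Q (a', b))" if "(Suc a', 0) \<le> (Suc a, 0)" for a'
  proof (cases "a' = a")
    case False
    then have "(Suc a', 0) \<le> (a, Suc 0)"
      using that by (auto simp: less_eq_prod_def)
    then show ?thesis
      using W[OF f[of 0]] unfolding monic_tower_def by blast
  qed (use b in blast)
  moreover have "degree (Q first_idx) = 1"
    using W[OF f[of 0]] by (simp add: monic_tower_def)
  ultimately show ?thesis
    unfolding monic_tower_def by blast
qed

lemma step_monic_tower:
  assumes W: "monic_tower Q \<alpha> l" and l: "first_idx \<le> l" and p: "CHAR('k) > 0"
    and st: "step Q \<alpha> l N" and k: "enat k \<le> N" and n: "degree (Q l) \<le> degree f"
  shows "monic_tower Q \<alpha> (l \<oplus>\<^sub>i k) \<and> degree (Q l) \<le> degree (Q (l \<oplus>\<^sub>i k)) \<and>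
    degree (Q (l \<oplus>\<^sub>i k)) \<le> degree f"
proof (cases "k = 0")
  case True
  then show ?thesis
    using W n by (simp add: idx_add_def)
next
  case False
  let ?R = "G\<lparr>carrier := G_less Q l\<rparr>"
  obtain F g where F: "monic_factorization ?R (in_l Q l) F" "g \<in> F"
    and br: "if (card F, deg ?R g) \<noteq> (1, 1)
        then N = 1 \<and> \<alpha> (l \<oplus>\<^sub>i 1) = deg ?R g \<and> lifting Q \<alpha> l g (Q (l \<oplus>\<^sub>i 1))
        else step_B Q \<alpha> l N"
    using st unfolding step_def Let_def by blast
  show ?thesis
  proof (cases "(card F, deg ?R g) \<noteq> (1, 1)")
    case True
    then have N: "N = 1" and \<alpha>: "\<alpha> (l \<oplus>\<^sub>i 1) = deg ?R g" and lift: "lifting Q \<alpha> l g (Q (l \<oplus>\<^sub>i 1))"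
      using br by simp_all
    have k1: "k = 1"
      using False k N by (simp add: one_enat_def)
    interpret UP_cring ?R "UP ?R"
      using cring_G_less by (simp add: UP_cring_def)
    have d: "0 < deg ?R g"
      using F by (intro irreducible_monic_deg_pos) (auto simp: monic_factorization_def)
    note deg = lifting_degree[OF W l lift d]
    have "monic_tower Q \<alpha> (l \<oplus>\<^sub>i 1)"
    proof (rule monic_tower_extend[OF W l])
      fix j :: nat assume "1 \<le> j" "j \<le> 1"
      then have j: "j = 1"
        by simp
      have l0: "l \<oplus>\<^sub>i (1 - 1) = l"
        by (simp add: idx_add_def)
      have "1 \<le> deg ?R g"
        using d by linarith
      then show "lead_coeff (Q (l \<oplus>\<^sub>i j)) = 1 \<and> 1 \<le> \<alpha> (l \<oplus>\<^sub>i j) \<and>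
          degree (Q (l \<oplus>\<^sub>i j)) = \<alpha> (l \<oplus>\<^sub>i j) * degree (Q (l \<oplus>\<^sub>i (j - 1)))"
        unfolding j \<alpha> l0 using deg by blast
    qed
    moreover have "deg ?R g * degree (Q l) \<le> degree f"
      using monic_factor_degree_le[OF monic_tower_degree_pos[OF W l order_refl] F] .
    moreover have "1 * degree (Q l) \<le> deg ?R g * degree (Q l)"
      using d by (intro mult_right_mono) auto
    ultimately show ?thesis
      unfolding k1 using deg by (metis mult_1)
  next
    case notA: False
    then have "step_B Q \<alpha> l N"
      using br by auto
    from step_B_T_seq[OF this p k] obtain zs where T: "T_seq Q \<alpha> l zs"
      and Q: "\<And>j. 1 \<le> j \<Longrightarrow> j \<le> k \<Longrightarrow> \<alpha> (l \<oplus>\<^sub>i j) = 1 \<and> Q (l \<oplus>\<^sub>i j) = Q l + sum_list (take j zs)"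
      by blast
    have deg: "degree (Q (l \<oplus>\<^sub>i j)) = degree (Q l) \<and> lead_coeff (Q (l \<oplus>\<^sub>i j)) = 1" if "j \<le> k" for j
    proof (cases "j = 0")
      case True
      then show ?thesis
        using monic_tower_lead_coeff[OF W l order_refl] by (simp add: idx_add_def)
    next
      case False
      then have "Q (l \<oplus>\<^sub>i j) = Q l + sum_list (take j zs)"
        using Q[of j] that by simp
      then show ?thesis
        using T_seq_degree[OF W l T, of j] by metis
    qed
    have "monic_tower Q \<alpha> (l \<oplus>\<^sub>i k)"
    proof (rule monic_tower_extend[OF W l])
      fix j assume j: "1 \<le> j" "j \<le> k"
      have "\<alpha> (l \<oplus>\<^sub>i j) = 1"
        using Q[OF j] by blast
      then show "lead_coeff (Q (l \<oplus>\<^sub>i j)) = 1 \<and> 1 \<le> \<alpha> (l \<oplus>\<^sub>i j) \<and>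
          degree (Q (l \<oplus>\<^sub>i j)) = \<alpha> (l \<oplus>\<^sub>i j) * degree (Q (l \<oplus>\<^sub>i (j - 1)))"
        using deg[OF j(2)] deg[of "j - 1"] j(2) by (metis diff_le_self le_trans mult_1 order_refl)
    qed
    then show ?thesis
      using deg[OF order_refl] n by (metis order_refl)
  qed
qed


section \<open>The number of limit steps\<close>

text \<open>
  Some coefficient of the expansion of \<open>f\<close> is non-zero of degree less than $\deg f$, hence has finite
  value; as $Q_i$ has finite value too, the minimum defining $\delta_i(f)$ is finite and the
  coefficient at $\delta_i(f)$ cannot vanish.
\<close>

lemma delta_l_mult_degree_le:
  assumes q: "0 < degree (Q i)" "degree (Q i) \<le> degree f" and ev: "ev (Q i) \<noteq> 0"
  shows "delta_l Q i * degree (Q i) \<le> degree f"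
proof -
  let ?L = "line_value (Q i) f (val (Q i))"
  have f0: "f \<noteq> 0"
    using degree_f_pos by auto
  obtain j where j: "digit (Q i) f j \<noteq> 0"
    using div_power_eq_0_if_digits_eq_0[OF q(1), of 0 f] f0 by auto
  have "1 * j \<le> j * degree (Q i)"
    using q(1) by (subst mult.commute) (intro mult_left_mono, auto)
  then have jn: "j \<le> degree f"
    using digit_neq_0_imp_le[OF q(1) j] by linarith
  have "Q i \<noteq> 0"
    using q(1) by auto
  then have "degree (digit (Q i) f j) < degree f"
    using degree_mod_less'[of "Q i" "f div Q i ^ j"] q j by (auto simp: digit_def)
  then have "val (digit (Q i) f j) \<noteq> \<infinity>"
    using ev_neq_0[OF j] val_eq_infinity_iff by blast
  moreover have "val (Q i) \<noteq> \<infinity>"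
    using ev val_eq_infinity_iff by blast
  ultimately have "?L j \<noteq> \<infinity>"
    by (cases "val (Q i)"; cases "val (digit (Q i) f j)") (auto simp: line_value_def)
  moreover have "min_value (Q i) f (val (Q i)) \<le> ?L j"
    unfolding min_value_def using jn by (intro Min_le) auto
  ultimately have fin: "min_value (Q i) f (val (Q i)) \<noteq> \<infinity>"
    by auto
  have "min_value (Q i) f (val (Q i)) \<in> ?L ` {..degree f}"
    unfolding min_value_def by (intro Min_in) auto
  then have "support_on (Q i) f (val (Q i)) \<noteq> {}"
    by (auto simp: support_on_def)
  moreover have "finite (support_on (Q i) f (val (Q i)))"
    by (rule finite_subset[of _ "{..degree f}"]) (auto simp: support_on_def)
  ultimately have "delta_l Q i \<in> support_on (Q i) f (val (Q i))"
    unfolding delta_l_def by (rule Max_in[rotated])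
  then have "?L (delta_l Q i) \<noteq> \<infinity>"
    using fin by (simp add: support_on_def)
  then have "digit (Q i) f (delta_l Q i) \<noteq> 0"
    using val_eq_infinity_iff[of 0] val_not_MInf[of "Q i"]
    by (cases "val (Q i)") (auto simp: line_value_def ev_0)
  then show ?thesis
    by (rule digit_neq_0_imp_le[OF q(1)])
qed

text \<open>
  The witness must contribute a positive number of new indices: a finite step (B) may add none, and
  the same index is then a stage again.
\<close>

lemma
  fixes a :: nat
  shows stage_comes_from: "stage Q N l \<Longrightarrow> l = (a, Suc b) \<Longrightarrow> l \<noteq> first_idx \<Longrightarrow>
      \<exists>c\<le>b. stage Q N (a, c) \<and> ev (Q (a, c)) \<noteq> 0 \<and> enat (Suc b - c) \<le> N (a, c)"
    and produced_comes_from: "produced Q N l \<Longrightarrow> l = (a, Suc b) \<Longrightarrow> l \<noteq> first_idx \<Longrightarrow>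
      \<exists>c\<le>b. stage Q N (a, c) \<and> ev (Q (a, c)) \<noteq> 0 \<and> enat (Suc b - c) \<le> N (a, c)"
proof (induction rule: stage_produced.inducts)
  case (continue l r)
  show ?case
  proof (cases "r = 0")
    case False
    obtain c where "l = (a, c)" "Suc b - c = r" "c \<le> b"
      using continue.prems False by (cases l) (auto simp: idx_add_def)
    then show ?thesis
      using continue by auto
  qed (use continue in \<open>auto simp: idx_add_def\<close>)
next
  case (new l k)
  show ?case
  proof (cases "k = 0")
    case False
    obtain c where "l = (a, c)" "Suc b - c = k" "c \<le> b"
      using new.prems False by (cases l) (auto simp: idx_add_def)
    then show ?thesis
      using new by auto
  qed (use new in \<open>auto simp: idx_add_def\<close>)
qed auto

text \<open>
  Two consecutive key polynomials added in the same step (B) differ by an element that is non-zero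
  in the extension field.
\<close>

lemma consecutive_not_both_0:
  assumes steps: "\<And>l. stage Q N l \<Longrightarrow> ev (Q l) \<noteq> 0 \<Longrightarrow> step Q \<alpha> l (N l)" and p: "CHAR('k) > 0"
    and pr: "produced Q N (a, Suc b)" "first_idx \<le> (a, b)"
  shows "ev (Q (a, b)) \<noteq> 0 \<or> ev (Q (a, Suc b)) \<noteq> 0"
proof -
  have "(a, Suc b) \<noteq> first_idx"
    using pr(2) by (auto simp: first_idx_def less_eq_prod_def)
  then obtain c where c: "c \<le> b" "stage Q N (a, c)" "ev (Q (a, c)) \<noteq> 0" "enat (Suc b - c) \<le> N (a, c)"
    using produced_comes_from[OF pr(1) refl] by blast
  show ?thesis
  proof (cases "c = b")
    case False
    with c(1) have cb: "c < b"
      by simp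
    have "\<not> N (a, c) = 1"
    proof
      assume "N (a, c) = 1"
      then have "Suc b - c \<le> 1"
        using c(4) by (simp add: one_enat_def)
      then show False
        using cb by simp
    qed
    then have "step_B Q \<alpha> (a, c) (N (a, c))"
      using steps[OF c(2,3)] unfolding step_def Let_def by metis
    from step_B_T_seq[OF this p c(4)] obtain zs where T: "T_seq Q \<alpha> (a, c) zs"
      and len: "Suc b - c \<le> length zs"
      and Q: "\<And>j. 1 \<le> j \<Longrightarrow> j \<le> Suc b - c \<Longrightarrow> Q ((a, c) \<oplus>\<^sub>i j) = Q (a, c) + sum_list (take j zs)"
      by blast
    have "Q (a, Suc b) = Q (a, c) + sum_list (take (Suc (b - c)) zs)"
      using Q[of "Suc b - c"] cb by (simp add: idx_add_def Suc_diff_le)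
    moreover have "Q (a, b) = Q (a, c) + sum_list (take (b - c) zs)"
      using Q[of "b - c"] cb by (simp add: idx_add_def)
    moreover have lt: "b - c < length zs"
      using len cb by simp
    ultimately have "Q (a, Suc b) = Q (a, b) + zs ! (b - c)"
      by (simp add: take_Suc_conv_app_nth add.assoc)
    then show ?thesis
      using T_seq_ev_neq_0[OF T lt] by (auto simp: ev_add)
  qed (use c in simp)
qed

text \<open>
  With $\delta = p^e u$ and $e_0 \le e$, the limit key polynomial has degree
  $p^{e_0} \deg Q_i \le \delta \deg Q_i \le \deg f$.
\<close>

lemma limit_step_monic_tower:
  assumes W: "\<And>b. first_idx \<le> (a, b) \<Longrightarrow> monic_tower Q \<alpha> (a, b) \<and>
      CHAR('k) ^ a \<le> degree (Q (a, b)) \<and> degree (Q (a, b)) \<le> degree f"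
    and nz: "\<And>b. first_idx \<le> (a, b) \<Longrightarrow> ev (Q (a, b)) \<noteq> 0 \<or> ev (Q (a, Suc b)) \<noteq> 0"
    and p: "CHAR('k) > 0" and lim: "limit_step Q \<alpha> a"
  shows "monic_tower Q \<alpha> (Suc a, 0) \<and> CHAR('k) ^ Suc a \<le> degree (Q (Suc a, 0)) \<and>
    degree (Q (Suc a, 0)) \<le> degree f"
proof -
  let ?p = "CHAR('k)"
  obtain b \<delta> e u e\<^sub>0 \<beta> where b: "first_idx \<le> (a, b)"
    and \<alpha>: "\<forall>t>0. \<alpha> ((a, b) \<oplus>\<^sub>i t) = 1" and \<delta>: "\<forall>t. delta_l Q ((a, b) \<oplus>\<^sub>i t) = \<delta>"
    and \<delta>_eq: "\<delta> = ?p ^ e * u" and u: "\<not> ?p dvd u"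
    and e\<^sub>0: "1 \<le> e\<^sub>0" "e\<^sub>0 \<le> e" and cand: "limit_candidate Q \<alpha> (a, b) \<beta> e\<^sub>0 (Q (add_omega (a, b)))"
    and \<alpha>_lim: "\<alpha> (add_omega (a, b)) = ?p ^ e\<^sub>0"
    using lim unfolding limit_step_def Let_def by blast
  have fi: "first_idx \<le> (a, b + t)" for t
    using b by (auto simp: less_eq_prod_def)
  have deg: "degree (Q ((a, b) \<oplus>\<^sub>i t)) = degree (Q (a, b))" for t
  proof (rule monic_tower_degree_const[OF _ b order_refl])
    show "monic_tower Q \<alpha> ((a, b) \<oplus>\<^sub>i t)"
      using W[OF fi[of t]] by (simp add: idx_add_def)
  qed (use \<alpha> in blast)
  have D: "0 < degree (Q (a, b))"
    using monic_tower_degree_pos[OF _ b order_refl] W[OF b] by blast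
  obtain t where dig: "digit (Q ((a, b) \<oplus>\<^sub>i t)) (Q (Suc a, 0)) (?p ^ e\<^sub>0) = 1"
      "\<And>j. ?p ^ e\<^sub>0 < j \<Longrightarrow> digit (Q ((a, b) \<oplus>\<^sub>i t)) (Q (Suc a, 0)) j = 0"
    using cand unfolding limit_candidate_def Let_def add_omega_def by auto
  have "lead_coeff (Q ((a, b) \<oplus>\<^sub>i t)) = 1"
    using monic_tower_lead_coeff[OF conjunct1[OF W[OF fi[of t]]] fi[of t] order_refl]
    by (simp add: idx_add_def)
  then have lim_deg: "degree (Q (Suc a, 0)) = ?p ^ e\<^sub>0 * degree (Q (a, b))"
    and lim_lc: "lead_coeff (Q (Suc a, 0)) = 1"
    using degree_lead_coeff_if_top_digit_1[OF _ _ dig] D deg by auto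
  have pe: "?p \<le> ?p ^ e\<^sub>0"
    using p e\<^sub>0(1) by (simp add: self_le_power)
  have "?p * ?p ^ a \<le> ?p ^ e\<^sub>0 * degree (Q (a, b))"
    using pe W[OF b] by (intro mult_mono) auto
  then have lower: "?p ^ Suc a \<le> degree (Q (Suc a, 0))"
    using lim_deg by simp
  have "u \<noteq> 0"
    using u by (metis dvd_0_right)
  then have "?p ^ e\<^sub>0 \<le> \<delta>"
    using \<delta>_eq power_increasing[OF e\<^sub>0(2), of ?p] p by (metis One_nat_def Suc_leI mult.right_neutral mult_le_mono neq0_conv)
  \<comment> \<open>Any index from \<open>(a, b)\<close> on would do, since $\delta$ and the degree are the same for all of them.\<close>
  moreover obtain s where s: "ev (Q ((a, b) \<oplus>\<^sub>i s)) \<noteq> 0"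
    using nz[OF b] by (metis add.right_neutral add_Suc_right fst_conv idx_add_def snd_conv)
  have "delta_l Q ((a, b) \<oplus>\<^sub>i s) * degree (Q ((a, b) \<oplus>\<^sub>i s)) \<le> degree f"
    using deg D W[OF b] s by (intro delta_l_mult_degree_le) auto
  then have "\<delta> * degree (Q (a, b)) \<le> degree f"
    using \<delta> deg by simp
  ultimately have "degree (Q (Suc a, 0)) \<le> degree f"
    unfolding lim_deg by (meson mult_le_mono1 order_trans)
  moreover have "monic_tower Q \<alpha> (Suc a, 0)"
    using W lim_lc b \<alpha> lim_deg \<alpha>_lim p by (intro monic_tower_limit[of a Q \<alpha> b]) (auto simp: add_omega_def)
  ultimately show ?thesis
    using lower by blast
qed

lemma produced_degree_bounds:
  assumes start: "Q first_idx = [:0, 1:]" "\<alpha> first_idx = 1"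
    and steps: "\<And>l. stage Q N l \<Longrightarrow> ev (Q l) \<noteq> 0 \<Longrightarrow> step Q \<alpha> l (N l)"
    and limits: "\<And>a. stage Q N (Suc a, 0) \<Longrightarrow> limit_step Q \<alpha> a"
    and p: "CHAR('k) > 0"
  defines "I l \<equiv> first_idx \<le> l \<and> monic_tower Q \<alpha> l \<and> CHAR('k) ^ fst l \<le> degree (Q l) \<and> degree (Q l) \<le> degree f"
  shows "stage Q N l \<Longrightarrow> I l" and "produced Q N l \<Longrightarrow> I l"
proof -
  have add: "I (l \<oplus>\<^sub>i k)" if "I l" "stage Q N l" "ev (Q l) \<noteq> 0" "enat k \<le> N l" for l k
  proof -
    have "l \<le> l \<oplus>\<^sub>i k"
      by (auto simp: idx_add_def less_eq_prod_def)
    moreover have f: "fst (l \<oplus>\<^sub>i k) = fst l"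
      by (simp add: idx_add_def)
    moreover have I: "first_idx \<le> l" "monic_tower Q \<alpha> l" "CHAR('k) ^ fst l \<le> degree (Q l)" "degree (Q l) \<le> degree f"
      using that(1) by (simp_all only: I_def)
    moreover note step_monic_tower[OF I(2,1) p steps[OF that(2,3)] that(4) I(4)]
    ultimately show ?thesis
      unfolding I_def f by (blast intro: order_trans)
  qed
  show "stage Q N l \<Longrightarrow> I l" and "produced Q N l \<Longrightarrow> I l"
  proof (induction rule: stage_produced.inducts)
    case start
    have "degree (Q first_idx) = 1 \<and> lead_coeff (Q first_idx) = 1"
      using assms(1) by simp
    moreover have "\<not> i \<oplus>\<^sub>i 1 \<le> first_idx" if "first_idx \<le> i" for i
      using that by (auto simp: idx_add_def first_idx_def less_eq_prod_def)
    moreover have "\<not> (Suc a, 0) \<le> first_idx" for a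
      by (auto simp: first_idx_def less_eq_prod_def)
    ultimately show ?case
      unfolding I_def monic_tower_def using assms(2) degree_f_pos
      by (auto simp: first_idx_def)
  next
    case (limit a)
    have st: "stage Q N (Suc a, 0)"
      using limit by (intro stage_produced.limit) auto
    have "ev (Q (a, b)) \<noteq> 0 \<or> ev (Q (a, Suc b)) \<noteq> 0" if b: "first_idx \<le> (a, b)" for b
    proof -
      have "first_idx \<le> (a, Suc b)"
        using b by (auto simp: less_eq_prod_def)
      then show ?thesis
        using consecutive_not_both_0[OF steps p] limit b by blast
    qed
    then have "monic_tower Q \<alpha> (Suc a, 0) \<and> CHAR('k) ^ Suc a \<le> degree (Q (Suc a, 0)) \<and>
        degree (Q (Suc a, 0)) \<le> degree f"
      using limit by (intro limit_step_monic_tower[OF _ _ p limits[OF st]]) (auto simp: I_def)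
    then show ?case
      by (auto simp: I_def first_idx_def less_eq_prod_def)
  next
    case (continue l r)
    then show ?case
      using add[of l r] by simp
  next
    case (new l k)
    then show ?case
      using add[of l k] by simp
  qed
qed

lemma
  assumes "CHAR('k) = 0"
  shows stage_char_0: "stage Q N l \<Longrightarrow> fst l = 0"
    and produced_char_0: "produced Q N l \<Longrightarrow> fst l = 0"
proof (induction rule: stage_produced.inducts)
  case (limit a)
  then show ?case
    using assms by blast
qed (simp_all add: first_idx_def idx_add_def)

end

theorem mainTheorem3:
  fixes \<iota> :: "'k::field \<Rightarrow> 'l::field"
    and \<nu> :: "'k \<Rightarrow> ereal"
    and \<nu>' :: "'l \<Rightarrow> ereal"
    and x :: 'l
    and f :: "'k poly"
    and \<Lambda> :: "idx set"
    and Q :: "idx \<Rightarrow> 'k poly"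
    and \<alpha> :: "idx \<Rightarrow> nat"
  assumes "valued_extension \<iota> \<nu> \<nu>' x f"
    and "valued_extension.key_polynomials \<iota> \<nu>' x f \<Lambda> Q \<alpha>"
  shows "(CHAR('k) = 0 \<longrightarrow> order_on_idx \<Lambda> \<le>o natLeq) \<and>
    (CHAR('k) > 0 \<longrightarrow>
      order_on_idx \<Lambda> \<le>o
        omega_times (nat \<lfloor>log (real CHAR('k)) (real (extension_degree \<iota>))\<rfloor> + 1))"
proof -
  interpret valued_extension \<iota> \<nu> \<nu>' x f
    by (rule assms(1))
  obtain N where start: "Q first_idx = [:0, 1:]" "\<alpha> first_idx = 1"
    and steps: "\<And>l. stage Q N l \<Longrightarrow> ev (Q l) \<noteq> 0 \<Longrightarrow> step Q \<alpha> l (N l)"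
    and limits: "\<And>a. stage Q N (Suc a, 0) \<Longrightarrow> limit_step Q \<alpha> a"
    and \<Lambda>: "\<Lambda> = {i. produced Q N i}"
    using assms(2) unfolding key_polynomials_def by blast
  show ?thesis
  proof (intro conjI impI)
    assume "CHAR('k) = 0"
    then have "fst i = 0" if "i \<in> \<Lambda>" for i
      using produced_char_0 that \<Lambda> by blast
    then have "(snd i, snd j) \<in> natLeq \<and> snd i \<noteq> snd j" if "i \<in> \<Lambda>" "j \<in> \<Lambda>" "i < j" for i j
      using that by (auto simp: less_prod_def natLeq_def)
    then show "order_on_idx \<Lambda> \<le>o natLeq"
      by (intro strict_mono_imp_ordLeq[where h = snd, OF natLeq_Well_order]) (auto simp: Field_natLeq)
  next
    assume p: "CHAR('k) > 0"
    let ?p = "CHAR('k)" and ?m = "nat \<lfloor>log (real CHAR('k)) (real (extension_degree \<iota>))\<rfloor>"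
    have "Factorial_Ring.prime ?p"
      using p by (rule prime_CHAR_semidom)
    then have p1: "1 < ?p"
      by (rule prime_gt_1_nat)
    have \<Lambda>_bound: "fst i < ?m + 1" if "i \<in> \<Lambda>" for i
    proof -
      have "produced Q N i"
        using that \<Lambda> by simp
      from produced_degree_bounds(2)[OF start steps limits p this]
      have "?p ^ fst i \<le> degree f"
        by (blast intro: order_trans)
      also have "\<dots> \<le> extension_degree \<iota>"
        by (rule degree_le_extension_degree)
      finally have "real (?p ^ fst i) \<le> real (extension_degree \<iota>)"
        by (rule of_nat_mono)
      moreover have "0 < real (?p ^ fst i)"
        using p by simp
      ultimately have "log ?p (real (?p ^ fst i)) \<le> log ?p (extension_degree \<iota>)"
        using p1 by (subst log_le_cancel_iff) linarith+
      then have "real (fst i) \<le> log ?p (extension_degree \<iota>)"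
        using p1 by (simp add: log_nat_power)
      then have "int (fst i) \<le> \<lfloor>log ?p (extension_degree \<iota>)\<rfloor>"
        by (simp add: le_floor_iff)
      then show ?thesis
        by linarith
    qed
    show "order_on_idx \<Lambda> \<le>o omega_times (?m + 1)"
      unfolding omega_times_def
    proof (rule strict_mono_imp_ordLeq[where h = "\<lambda>i. i", OF Well_order_order_on_idx])
      show "i \<in> Field (order_on_idx {i. fst i < ?m + 1})" if "i \<in> \<Lambda>" for i
        using \<Lambda>_bound[OF that] by (simp add: Field_order_on_idx)
      show "(i, j) \<in> order_on_idx {i. fst i < ?m + 1} \<and> i \<noteq> j" if "i \<in> \<Lambda>" "j \<in> \<Lambda>" "i < j" for i j
        using \<Lambda>_bound[OF that(1)] \<Lambda>_bound[OF that(2)] that(3) by (auto simp: order_on_idx_def)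
    qed
  qed
qed

end
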